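(* Let $k$ be a field of characteristic $\neq 2$, $n$ a positive integer, $\xi$ a generator of the group $U_n(k)$ of order $\nu(n)$ and $l, t \in \{0, \ldots, \nu(n) - 1\}$. Then: (1) Assume that one of the positive integers $n$ or $\nu(n)$ is odd. Then the Hopf algebras $H_{4n, \xi^l}$ and $H_{4n, \xi^t}$ are isomorphic if and only if there exists $s \in \{0, 1, \ldots, n-1\}$ such that $\gcd(s, n) = 1$ and $\nu(n) \mid l - ts$. (2) Assume that $n$ and $\nu(n)$ are both even. Then the Hopf algebras $H_{4n, \xi^l}$ and $H_{4n, \xi^t}$ are isomorphic if and only if there exists $s \in \{0, 1, \ldots, n-1\}$ such that $\gcd(s, n) = 1$ and one of the following conditions holds: $\nu(n) \mid l - ts$, or $2(l - ts) = \nu(n)\, q$ for some odd integer $q$.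
   Context: $U_n(k) = \{\omega \in k \mid \omega^n = 1\}$ is the cyclic group of $n$-th roots of unity in $k$ and $\nu(n) = |U_n(k)|$ is its order. For $\omega \in U_n(k)$, $H_{4n, \omega}$ is the $4n$-dimensional Hopf algebra over $k$ generated by $g, x, c$ subject to the relations $g^2 = c^n = 1$, $x^2 = 0$, $xg = -gx$, $cg = gc$, $cx = \omega\, xc$, with $\Delta(g) = g \otimes g$, $\Delta(c) = c \otimes c$, $\Delta(x) = x \otimes 1 + g \otimes x$, $\varepsilon(c) = \varepsilon(g) = 1$, $\varepsilon(x) = 0$, $S(c) = c^{n-1}$, $S(g) = g$, $S(x) = -gx$. *)

theory Defs
  imports
    Complex_Main
    "HOL-Algebra.Module"
    "HOL-Algebra.QuotRing"
    "HOL-Library.Poly_Mapping"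
    "HOL-Library.Product_Plus"
begin

section \<open>Formal linear combinations\<close>

text \<open>
  The finitely supported functions \<^typ>\<open>'a \<Rightarrow>\<^sub>0 'k\<close> are the vector space with basis \<^typ>\<open>'a\<close>;
  if \<^typ>\<open>'a\<close> is a monoid, written additively, their product is that of the monoid algebra.
\<close>

definition fscale :: "'k::field \<Rightarrow> ('a \<Rightarrow>\<^sub>0 'k) \<Rightarrow> ('a \<Rightarrow>\<^sub>0 'k)"
  where "fscale r p = Poly_Mapping.map ((*) r) p"

lemma lookup_fscale [simp]:
  "Poly_Mapping.lookup (fscale r p) x = r * Poly_Mapping.lookup p x"
  by (simp add: fscale_def Poly_Mapping.map.rep_eq when_def)

global_interpretation formal: vector_space "fscale :: 'k::field \<Rightarrow> ('a \<Rightarrow>\<^sub>0 'k) \<Rightarrow> ('a \<Rightarrow>\<^sub>0 'k)"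
  by unfold_locales
    (auto intro!: poly_mapping_eqI simp: Poly_Mapping.lookup_add algebra_simps)

text \<open>The linear extension of a map between bases.\<close>

definition formal_map :: "('a \<Rightarrow> 'b) \<Rightarrow> ('a \<Rightarrow>\<^sub>0 'k) \<Rightarrow> ('b \<Rightarrow>\<^sub>0 'k::field)"
  where "formal_map h p =
    (\<Sum>u\<in>Poly_Mapping.keys p. Poly_Mapping.single (h u) (Poly_Mapping.lookup p u))"


section \<open>Tensor products\<close>

text \<open>
  A vector space over \<^typ>\<open>'k\<close> is given by the operations of a \<^typ>\<open>('k, 'v) module\<close> record.
  The space \<open>V \<otimes> W\<close> is the space of formal combinations of pairs in
  \<^term>\<open>carrier V \<times> carrier W\<close> modulo the bilinearity relations; its elements are
  represented as cosets.
\<close>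

definition tensor_rels ::
    "('k::field, 'v, 'm) module_scheme \<Rightarrow> ('k, 'w, 'n) module_scheme \<Rightarrow> ('v \<times> 'w \<Rightarrow>\<^sub>0 'k) set"
  where "tensor_rels V W =
    {Poly_Mapping.single (a \<oplus>\<^bsub>V\<^esub> b, d) 1
       - Poly_Mapping.single (a, d) 1 - Poly_Mapping.single (b, d) 1
     | a b d. a \<in> carrier V \<and> b \<in> carrier V \<and> d \<in> carrier W} \<union>
    {Poly_Mapping.single (a, d \<oplus>\<^bsub>W\<^esub> e) 1
       - Poly_Mapping.single (a, d) 1 - Poly_Mapping.single (a, e) 1
     | a d e. a \<in> carrier V \<and> d \<in> carrier W \<and> e \<in> carrier W} \<union>
    {Poly_Mapping.single (r \<odot>\<^bsub>V\<^esub> a, d) 1 - Poly_Mapping.single (a, d) r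
     | r a d. a \<in> carrier V \<and> d \<in> carrier W} \<union>
    {Poly_Mapping.single (a, r \<odot>\<^bsub>W\<^esub> d) 1 - Poly_Mapping.single (a, d) r
     | r a d. a \<in> carrier V \<and> d \<in> carrier W}"

definition tensor_class ::
    "('k::field, 'v, 'm) module_scheme \<Rightarrow> ('k, 'w, 'n) module_scheme
      \<Rightarrow> ('v \<times> 'w \<Rightarrow>\<^sub>0 'k) \<Rightarrow> ('v \<times> 'w \<Rightarrow>\<^sub>0 'k) set"
  where "tensor_class V W p = {q. q - p \<in> formal.span (tensor_rels V W)}"

text \<open>
  The map \<open>f \<otimes> h\<close> into \<open>V' \<otimes> W'\<close>, for linear \<open>f\<close> and \<open>h\<close>. As with the maps out of quotients
  below, \<^const>\<open>the_elem\<close> selects the common value on all representatives of a coset.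
\<close>

definition tensor_map ::
    "('k::field, 'v2, 'm) module_scheme \<Rightarrow> ('k, 'w2, 'n) module_scheme
      \<Rightarrow> ('v \<Rightarrow> 'v2) \<Rightarrow> ('w \<Rightarrow> 'w2) \<Rightarrow> ('v \<times> 'w \<Rightarrow>\<^sub>0 'k) set \<Rightarrow> ('v2 \<times> 'w2 \<Rightarrow>\<^sub>0 'k) set"
  where "tensor_map V' W' f h T =
    the_elem ((\<lambda>p. tensor_class V' W' (formal_map (map_prod f h) p)) ` T)"


section \<open>Hopf algebras and their isomorphisms\<close>

text \<open>
  The record carries the structure maps only. Between Hopf algebras, the clause on the antipode
  in \<open>hopf_hom\<close> is implied by the other ones.
\<close>

record (overloaded) ('k::zero, 'h) hopf_algebra = "('k, 'h) module" +
  comult :: "'h \<Rightarrow> ('h \<times> 'h \<Rightarrow>\<^sub>0 'k) set"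
  counit :: "'h \<Rightarrow> 'k"
  antipode :: "'h \<Rightarrow> 'h"

definition hopf_hom ::
    "('k::field, 'h, 'm) hopf_algebra_scheme \<Rightarrow> ('k, 'l, 'n) hopf_algebra_scheme \<Rightarrow> ('h \<Rightarrow> 'l) set"
  where "hopf_hom H L =
    {f \<in> ring_hom H L.
       (\<forall>r. \<forall>a\<in>carrier H. f (r \<odot>\<^bsub>H\<^esub> a) = r \<odot>\<^bsub>L\<^esub> f a) \<and>
       (\<forall>a\<in>carrier H. comult L (f a) = tensor_map L L f f (comult H a)) \<and>
       (\<forall>a\<in>carrier H. counit L (f a) = counit H a) \<and>
       (\<forall>a\<in>carrier H. antipode L (f a) = f (antipode H a))}"

definition hopf_isomorphic ::
    "('k::field, 'h, 'm) hopf_algebra_scheme \<Rightarrow> ('k, 'l, 'n) hopf_algebra_scheme \<Rightarrow> bool"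
  where "hopf_isomorphic H L \<longleftrightarrow> (\<exists>f\<in>hopf_hom H L. bij_betw f (carrier H) (carrier L))"


section \<open>Free algebras\<close>

text \<open>
  The free monoid is a copy of the type of lists, written additively because
  the monoid algebra product on \<^typ>\<open>'a \<Rightarrow>\<^sub>0 'k\<close> expects an additive monoid of exponents.
\<close>

datatype 'x word = Word (letters: "'x list")

instantiation word :: (type) monoid_add
begin

definition zero_word :: "'a word" where "0 = Word []"

definition plus_word :: "'a word \<Rightarrow> 'a word \<Rightarrow> 'a word"
  where "u + v = Word (letters u @ letters v)"

instance
  by standard (simp_all add: zero_word_def plus_word_def)

end

type_synonym ('x, 'k) free_alg = "'x word \<Rightarrow>\<^sub>0 'k"

definition free_algebra :: "('x, 'k::field) free_alg ring"
  where "free_algebra =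
    \<lparr>carrier = UNIV, mult = (*), one = 1, zero = 0, add = (+)\<rparr>"

definition generator :: "'x \<Rightarrow> ('x, 'k::field) free_alg"
  where "generator x = Poly_Mapping.single (Word [x]) 1"

text \<open>The scalar \<open>r\<close> as an element \<open>r \<cdot> 1\<close> of a monoid algebra.\<close>

definition scalar :: "'k::field \<Rightarrow> ('m::monoid_add \<Rightarrow>\<^sub>0 'k)"
  where "scalar r = Poly_Mapping.single 0 r"

text \<open>
  The algebra map and the algebra anti-homomorphism on the free algebra that extend \<open>\<phi>\<close>.
  The target is a ring with unit map \<open>\<iota>\<close> from the base field.
\<close>

definition free_lift ::
    "('k::field \<Rightarrow> 'b::ring_1) \<Rightarrow> ('x \<Rightarrow> 'b) \<Rightarrow> ('x, 'k) free_alg \<Rightarrow> 'b"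
  where "free_lift \<iota> \<phi> p =
    (\<Sum>w\<in>Poly_Mapping.keys p.
       \<iota> (Poly_Mapping.lookup p w) * prod_list (map \<phi> (letters w)))"

definition free_antilift ::
    "('k::field \<Rightarrow> 'b::ring_1) \<Rightarrow> ('x \<Rightarrow> 'b) \<Rightarrow> ('x, 'k) free_alg \<Rightarrow> 'b"
  where "free_antilift \<iota> \<phi> p =
    (\<Sum>w\<in>Poly_Mapping.keys p.
       \<iota> (Poly_Mapping.lookup p w) * prod_list (map \<phi> (rev (letters w))))"


section \<open>Roots of unity\<close>

definition roots_of_unity :: "nat \<Rightarrow> 'k::field set"
  where "roots_of_unity n = {\<omega>. \<omega> ^ n = 1}"

definition generates_roots_of_unity :: "nat \<Rightarrow> 'k::field \<Rightarrow> bool"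
  where "generates_roots_of_unity n \<xi> \<longleftrightarrow> roots_of_unity n = range (\<lambda>i::int. \<xi> powi i)"


section \<open>The Hopf algebras \<open>H\<^sub>4\<^sub>n\<^sub>,\<^sub>\<omega>\<close>\<close>

text \<open>
  The algebra is given by its presentation, as a quotient of the free algebra on three generators.
  In \<open>H4n_relators\<close> a relation \<open>p = q\<close> is listed as \<open>p - q\<close>.
\<close>

datatype gen = Gen_g | Gen_x | Gen_c

abbreviation (input) fg :: "(gen, 'k::field) free_alg" where "fg \<equiv> generator Gen_g"
abbreviation (input) fx :: "(gen, 'k::field) free_alg" where "fx \<equiv> generator Gen_x"
abbreviation (input) fc :: "(gen, 'k::field) free_alg" where "fc \<equiv> generator Gen_c"

definition H4n_relators :: "nat \<Rightarrow> 'k::field \<Rightarrow> (gen, 'k) free_alg set"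
  where "H4n_relators n \<omega> =
    {fg ^ 2 - 1, fc ^ n - 1, fx ^ 2, fx * fg - (- (fg * fx)), fc * fg - fg * fc,
     fc * fx - scalar \<omega> * (fx * fc)}"

definition H4n_ideal :: "nat \<Rightarrow> 'k::field \<Rightarrow> (gen, 'k) free_alg set"
  where "H4n_ideal n \<omega> = Idl\<^bsub>free_algebra\<^esub> (H4n_relators n \<omega>)"

definition H4n_class :: "nat \<Rightarrow> 'k::field \<Rightarrow> (gen, 'k) free_alg \<Rightarrow> (gen, 'k) free_alg set"
  where "H4n_class n \<omega> p = H4n_ideal n \<omega> +>\<^bsub>free_algebra\<^esub> p"

definition H4n_algebra :: "nat \<Rightarrow> 'k::field \<Rightarrow> ('k, (gen, 'k) free_alg set) module"
  where "H4n_algebra n \<omega> =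
    ring.extend (free_algebra Quot H4n_ideal n \<omega>)
      (module.fields
        (\<lambda>r A. H4n_class n \<omega> (scalar r) \<otimes>\<^bsub>free_algebra Quot H4n_ideal n \<omega>\<^esub> A))"

text \<open>
  The structure maps are the algebra (anti-)homomorphisms with the prescribed values on the
  generators, first on the free algebra and then on the quotient; the relators generate a Hopf
  ideal if \<open>\<omega> ^ n = 1\<close> and \<open>n > 0\<close>, so that they are constant on cosets. For the comultiplication,
  the tensor square of the free algebra is the monoid algebra of pairs of words, and
  \<open>ftensor p q\<close> is \<open>p \<otimes> q\<close> in it.
\<close>

definition ftensor ::
    "('x, 'k::field) free_alg \<Rightarrow> ('x, 'k) free_alg \<Rightarrow> ('x word \<times> 'x word \<Rightarrow>\<^sub>0 'k)"
  where "ftensor p q = formal_map (\<lambda>u. (u, 0)) p * formal_map (\<lambda>v. (0, v)) q"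

fun comult_gen :: "gen \<Rightarrow> (gen word \<times> gen word \<Rightarrow>\<^sub>0 'k::field)"
  where
    "comult_gen Gen_g = ftensor fg fg"
  | "comult_gen Gen_c = ftensor fc fc"
  | "comult_gen Gen_x = ftensor fx 1 + ftensor fg fx"

fun counit_gen :: "gen \<Rightarrow> 'k::field"
  where
    "counit_gen Gen_g = 1"
  | "counit_gen Gen_c = 1"
  | "counit_gen Gen_x = 0"

fun antipode_gen :: "nat \<Rightarrow> gen \<Rightarrow> (gen, 'k::field) free_alg"
  where
    "antipode_gen n Gen_g = fg"
  | "antipode_gen n Gen_c = fc ^ (n - 1)"
  | "antipode_gen n Gen_x = - (fg * fx)"

text \<open>The projection of the tensor square of the free algebra onto that of the quotient.\<close>

definition H4n_tensor_class ::
    "nat \<Rightarrow> 'k::field \<Rightarrow> (gen word \<times> gen word \<Rightarrow>\<^sub>0 'k)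
      \<Rightarrow> ((gen, 'k) free_alg set \<times> (gen, 'k) free_alg set \<Rightarrow>\<^sub>0 'k) set"
  where "H4n_tensor_class n \<omega> p =
    tensor_class (H4n_algebra n \<omega>) (H4n_algebra n \<omega>)
      (formal_map (\<lambda>(u, v). (H4n_class n \<omega> (Poly_Mapping.single u 1),
                       H4n_class n \<omega> (Poly_Mapping.single v 1))) p)"

definition H4n :: "nat \<Rightarrow> 'k::field \<Rightarrow> ('k, (gen, 'k) free_alg set) hopf_algebra"
  where "H4n n \<omega> =
    module.extend (H4n_algebra n \<omega>)
      (hopf_algebra.fields
        (\<lambda>A. the_elem ((\<lambda>p. H4n_tensor_class n \<omega> (free_lift scalar comult_gen p)) ` A))
        (\<lambda>A. the_elem (free_lift (\<lambda>r. r) counit_gen ` A))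
        (\<lambda>A. the_elem ((\<lambda>p. H4n_class n \<omega> (free_antilift scalar (antipode_gen n) p)) ` A)))"

end

theory Submission
  imports Defs
begin

text \<open>
  Write \<open>H\<^sub>\<omega>\<close> for \<open>H\<^sub>4\<^sub>n\<^sub>,\<^sub>\<omega>\<close>. It has the basis \<open>x\<^sup>j g\<^sup>i c\<^sup>k\<close> with \<open>j, i < 2\<close> and \<open>k < n\<close>, since the relations
  allow every word to be sorted at the price of a scalar. The coordinates with respect to this basis
  (\<open>coord\<close>) decide equality in the presented algebra (\<open>coord_eq_0_iff\<close>), and pairs of coordinates
  are functionals that tell elements of \<open>H\<^sub>\<omega> \<otimes> H\<^sub>\<omega>\<close> apart. In these terms the comultiplication takes a
  simple form (\<open>coord_comult\<close>), from which the elements of interest can be read off: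

  \<^item> the group-like elements are the \<open>g\<^sup>i c\<^sup>k\<close> (\<open>grouplike_cong\<close>);
  \<^item> an element \<open>p\<close> with \<open>\<Delta>(p) = p \<otimes> 1 + h \<otimes> p\<close>, for \<open>h = g\<^sup>i c\<^sup>k\<close>, has the form \<open>b x + a (1 - h)\<close>, and
    \<open>b \<noteq> 0\<close> is possible for \<open>h = g\<close> only (\<open>skew_primitive_cong\<close>).

  Now let \<open>f\<close> be an isomorphism from \<open>H\<^sub>\<omega>\<^sub>'\<close> to \<open>H\<^sub>\<omega>\<close>. It maps \<open>g\<close> and \<open>c\<close> to group-like elements \<open>h\<close> and
  \<open>g\<^sup>e c\<^sup>s\<close>, and \<open>x\<close> to some \<open>b x + a (1 - h)\<close>. Here \<open>b \<noteq> 0\<close>, as otherwise \<open>x\<close> and \<open>a (1 - g)\<close> would have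
  the same image; hence \<open>h = g\<close>. Comparing coordinates in the image of \<open>c x = \<omega>' x c\<close> gives
  \<open>\<omega>' = (-1)\<^sup>e \<omega>\<^sup>s\<close>, the relation \<open>c\<^sup>n = 1\<close> makes \<open>e n\<close> even, and \<open>s\<close> is prime to \<open>n\<close> since \<open>f\<close> is
  injective on the group generated by \<open>g\<close> and \<open>c\<close>. Conversely, if \<open>e\<close> and \<open>s\<close> satisfy these three
  conditions, then the substitution \<open>c \<mapsto> g\<^sup>e c\<^sup>s\<close> respects the relations and all structure maps, and
  it is inverted by \<open>c \<mapsto> g\<^sup>e c\<^sup>s\<^sup>'\<close> where \<open>s s' \<equiv> 1\<close> modulo \<open>n\<close>. This is \<open>H4n_isomorphic_iff\<close>.

  It remains to translate the condition into exponents of \<open>\<xi>\<close>, whose order is \<open>\<nu>\<close>. If \<open>n\<close> or \<open>\<nu>\<close> is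
  odd, then \<open>(-1)\<^sup>e = 1\<close> whenever \<open>e n\<close> is even. If both are even, \<open>e\<close> is arbitrary and \<open>-1\<close> is the
  power of \<open>\<xi>\<close> with exponent \<open>\<nu> / 2\<close>, which yields the second alternative.
\<close>


section \<open>Additive maps on formal combinations\<close>

lemma poly_mapping_induct [case_names single add]:
  fixes p :: "'a \<Rightarrow>\<^sub>0 'b::comm_monoid_add"
  assumes single: "\<And>u r. P (Poly_Mapping.single u r)"
    and add: "\<And>p q. P p \<Longrightarrow> P q \<Longrightarrow> P (p + q)"
  shows "P p"
proof -
  have "P (\<Sum>u\<in>S. Poly_Mapping.single u (Poly_Mapping.lookup p u))" if "finite S" for S
    using that
  proof (induction S rule: finite_induct)
    case empty
    then show ?case using single[of undefined 0] by simp
  next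
    case (insert u S)
    then show ?case by (simp add: single add)
  qed
  moreover have "p = (\<Sum>u\<in>Poly_Mapping.keys p. Poly_Mapping.single u (Poly_Mapping.lookup p u))"
    by (rule poly_mapping_eqI)
      (auto simp: Poly_Mapping.lookup_sum lookup_single when_def in_keys_iff)
  ultimately show ?thesis by (metis finite_keys)
qed

lemma additive_keys_sum:
  fixes F :: "'a \<Rightarrow> 'b::ab_group_add \<Rightarrow> 'c::ab_group_add"
  assumes "\<And>u. additive (F u)"
  shows "additive (\<lambda>p. \<Sum>u\<in>Poly_Mapping.keys p. F u (Poly_Mapping.lookup p u))"
  by (rule additive.intro, rule setsum_keys_plus_distrib)
    (simp_all add: additive.zero[OF assms] additive.add[OF assms])

lemma additive_eqI:
  fixes f g :: "('a \<Rightarrow>\<^sub>0 'b::ab_group_add) \<Rightarrow> 'c::ab_group_add"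
  assumes "additive f" "additive g"
    and "\<And>u r. f (Poly_Mapping.single u r) = g (Poly_Mapping.single u r)"
  shows "f p = g p"
  by (induction p rule: poly_mapping_induct) (simp_all add: assms additive.add)

lemma fscale_single [simp]:
  "fscale r (Poly_Mapping.single u s) = Poly_Mapping.single u (r * s)"
  by (rule poly_mapping_eqI) (simp add: lookup_single when_def)

lemma additive_fscale: "additive (fscale r)"
  by (rule additive.intro) (rule formal.scale_right_distrib)

lemma additive_formal_map: "additive (formal_map h)"
  unfolding formal_map_def
  by (rule additive_keys_sum) (simp add: additive_def single_add)

lemmas formal_map_add = additive.add[OF additive_formal_map]
lemmas formal_map_diff = additive.diff[OF additive_formal_map]

lemma formal_map_single [simp]:
  "formal_map h (Poly_Mapping.single u r) = Poly_Mapping.single (h u) r"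
  by (cases "r = 0") (simp_all add: formal_map_def)

lemma formal_map_fscale: "formal_map h (fscale r p) = fscale r (formal_map h p)"
  by (induction p rule: poly_mapping_induct)
    (simp_all add: formal_map_add formal.scale_right_distrib)

lemma formal_map_mult:
  fixes h :: "'a::monoid_add \<Rightarrow> 'b::monoid_add"
  assumes h: "\<And>u v. h (u + v) = h u + h v"
  shows "formal_map h (p * q) = formal_map h p * formal_map h q"
proof (induction p rule: poly_mapping_induct)
  case (single u r)
  show ?case
    by (induction q rule: poly_mapping_induct)
      (simp_all add: h mult_single formal_map_add distrib_left)
qed (simp add: formal_map_add distrib_right)


section \<open>Algebra homomorphisms on the free algebra\<close>

text \<open>
  The scalars have to be central for the extension of a map on generators to be multiplicative. The
  two unit maps that occur are \<^const>\<open>scalar\<close> and, for the counit, the identity of the field.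
\<close>

definition central_unit_map :: "('k::field \<Rightarrow> 'b::ring_1) \<Rightarrow> bool"
  where "central_unit_map \<iota> \<longleftrightarrow> additive \<iota> \<and> \<iota> 1 = 1 \<and> (\<forall>r s. \<iota> (r * s) = \<iota> r * \<iota> s)
    \<and> (\<forall>r b. \<iota> r * b = b * \<iota> r)"

lemma scalar_commute: "scalar r * p = p * scalar r"
  by (rule additive_eqI[where f = "\<lambda>p. scalar r * p"])
    (simp_all add: additive_def distrib_left distrib_right scalar_def mult_single mult.commute)

lemma additive_scalar: "additive scalar"
  unfolding scalar_def by (rule additive.intro) (rule single_add)

lemma scalar_mult: "scalar (r * s) = scalar r * scalar s"
  by (simp add: scalar_def mult_single)

lemma scalar_0 [simp]: "scalar 0 = 0" and scalar_1 [simp]: "scalar 1 = 1"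
  by (simp_all add: scalar_def)

lemma fscale_eq_scalar_mult: "fscale r p = scalar r * p"
  by (rule additive_eqI[OF additive_fscale])
    (auto simp: additive_def distrib_left scalar_def mult_single)

lemma central_unit_map_scalar: "central_unit_map scalar"
  unfolding central_unit_map_def
  by (intro conjI allI additive_scalar scalar_1 scalar_mult scalar_commute)

lemma central_unit_map_id: "central_unit_map (\<lambda>r. r)"
  by (simp add: central_unit_map_def additive_def mult.commute)

lemma single_Word_Cons:
  "Poly_Mapping.single (Word (a # w)) r = generator a * Poly_Mapping.single (Word w) r"
  by (simp add: generator_def mult_single plus_word_def)

lemma single_Word_Nil: "Poly_Mapping.single (Word []) r = scalar r"
  by (simp add: scalar_def zero_word_def)

text \<open>
  Letters are split off on the left because the coordinates below are computed by reading a word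
  from the left.
\<close>

lemma free_alg_induct [case_names scalar generator add]:
  fixes p :: "('x, 'k::field) free_alg"
  assumes "\<And>r. P (scalar r)" "\<And>a p. P p \<Longrightarrow> P (generator a * p)"
    and "\<And>p q. P p \<Longrightarrow> P q \<Longrightarrow> P (p + q)"
  shows "P p"
proof (induction p rule: poly_mapping_induct)
  case (single u r)
  have "P (Poly_Mapping.single (Word w) r)" for w
    by (induction w) (simp_all add: single_Word_Nil single_Word_Cons assms)
  then show ?case by (cases u) simp
qed (rule assms)

lemma central_unit_mapD:
  assumes "central_unit_map \<iota>"
  shows "additive \<iota>" "\<iota> 0 = 0" "\<iota> 1 = 1" "\<iota> (r * s) = \<iota> r * \<iota> s" "\<iota> r * b = b * \<iota> r"
  using assms additive.zero unfolding central_unit_map_def by blast+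

lemma additive_free_lift:
  assumes "central_unit_map \<iota>"
  shows "additive (free_lift \<iota> \<phi>)"
  unfolding free_lift_def
  by (intro additive_keys_sum)
    (simp add: additive_def distrib_right additive.add[OF central_unit_mapD(1)[OF assms]])

lemma free_lift_single:
  assumes "central_unit_map \<iota>"
  shows "free_lift \<iota> \<phi> (Poly_Mapping.single w r) = \<iota> r * prod_list (map \<phi> (letters w))"
  by (cases "r = 0") (simp_all add: free_lift_def central_unit_mapD(2)[OF assms])

lemma free_lift_mult:
  assumes \<iota>: "central_unit_map \<iota>"
  shows "free_lift \<iota> \<phi> (p * q) = free_lift \<iota> \<phi> p * free_lift \<iota> \<phi> q"
proof (induction p rule: poly_mapping_induct)
  case (single u r)
  note comm = central_unit_mapD(5)[OF \<iota>] and m = central_unit_mapD(4)[OF \<iota>]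
  show ?case
  proof (induction q rule: poly_mapping_induct)
    case (single v s)
    have "\<iota> r * (\<iota> s * (P * Q)) = \<iota> r * P * (\<iota> s * Q)" for P Q
      using arg_cong[OF comm[where b = P and r = s], of "\<lambda>z. \<iota> r * z * Q"] by (simp add: mult.assoc)
    then show ?case
      by (simp add: mult_single free_lift_single[OF \<iota>] plus_word_def m mult.assoc)
  qed (simp add: additive.add[OF additive_free_lift[OF \<iota>]] distrib_left)
qed (simp add: additive.add[OF additive_free_lift[OF \<iota>]] distrib_right)

lemma free_lift_generator [simp]:
  assumes "central_unit_map \<iota>"
  shows "free_lift \<iota> \<phi> (generator a) = \<phi> a"
  by (simp add: generator_def free_lift_single central_unit_mapD(3) assms)

lemma free_lift_scalar [simp]:
  assumes "central_unit_map \<iota>"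
  shows "free_lift \<iota> \<phi> (scalar r) = \<iota> r"
  using assms by (simp add: scalar_def free_lift_single zero_word_def)

lemma free_lift_one [simp]:
  assumes "central_unit_map \<iota>"
  shows "free_lift \<iota> \<phi> 1 = 1"
  using free_lift_scalar[OF assms, of \<phi> 1] by (simp add: central_unit_mapD(3) assms)

lemma free_lift_power:
  assumes "central_unit_map \<iota>"
  shows "free_lift \<iota> \<phi> (p ^ m) = free_lift \<iota> \<phi> p ^ m"
  by (induction m) (simp_all add: assms free_lift_mult)

lemma additive_free_antilift: "additive (free_antilift scalar \<phi>)"
  unfolding free_antilift_def
  by (intro additive_keys_sum) (simp add: additive_def distrib_right additive.add[OF additive_scalar])

lemma free_antilift_single:
  "free_antilift scalar \<phi> (Poly_Mapping.single w r) = scalar r * prod_list (map \<phi> (rev (letters w)))"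
  by (cases "r = 0") (simp_all add: free_antilift_def)

lemma free_antilift_mult:
  "free_antilift scalar \<phi> (p * q) = free_antilift scalar \<phi> q * free_antilift scalar \<phi> p"
proof (induction p rule: poly_mapping_induct)
  case (single u r)
  show ?case
  proof (induction q rule: poly_mapping_induct)
    case (single v s)
    have "scalar r * (scalar s * (Q * P)) = scalar s * Q * (scalar r * P)" for P Q
      using arg_cong[OF scalar_commute[of r "scalar s * Q"], of "\<lambda>z. z * P"]
      by (simp add: mult.assoc)
    then show ?case
      by (simp add: mult_single free_antilift_single plus_word_def scalar_mult mult.assoc)
  qed (simp add: additive.add[OF additive_free_antilift] distrib_left distrib_right)
qed (simp add: additive.add[OF additive_free_antilift] distrib_left distrib_right)

lemma free_antilift_generator [simp]: "free_antilift scalar \<phi> (generator a) = \<phi> a"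
  by (simp add: generator_def free_antilift_single)

lemma free_antilift_scalar [simp]: "free_antilift scalar \<phi> (scalar r) = scalar r"
  by (simp add: scalar_def free_antilift_single zero_word_def)

lemma free_antilift_one [simp]: "free_antilift scalar \<phi> 1 = 1"
  using free_antilift_scalar[of \<phi> 1] by simp

lemma free_antilift_power: "free_antilift scalar \<phi> (p ^ m) = free_antilift scalar \<phi> p ^ m"
  by (induction m) (simp_all add: free_antilift_mult power_commutes)


section \<open>The defining ideal\<close>

lemma free_algebra_simps [simp]:
  "carrier free_algebra = UNIV" "p \<otimes>\<^bsub>free_algebra\<^esub> q = p * q" "p \<oplus>\<^bsub>free_algebra\<^esub> q = p + q"
  "\<one>\<^bsub>free_algebra\<^esub> = 1" "\<zero>\<^bsub>free_algebra\<^esub> = 0"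
  by (simp_all add: free_algebra_def)

lemma ring_free_algebra: "ring (free_algebra :: ('x, 'k::field) free_alg ring)"
proof (rule ringI)
  show "abelian_group (free_algebra :: ('x, 'k) free_alg ring)"
  proof (rule abelian_groupI)
    show "\<exists>q\<in>carrier free_algebra. q \<oplus>\<^bsub>free_algebra\<^esub> p = \<zero>\<^bsub>free_algebra\<^esub>" for p :: "('x, 'k) free_alg"
      by (rule bexI[of _ "- p"]) simp_all
  qed (simp_all add: algebra_simps)
  show "Group.monoid (free_algebra :: ('x, 'k) free_alg ring)"
    by (rule monoidI) (simp_all add: mult.assoc)
qed (simp_all add: algebra_simps)

lemma a_inv_free_algebra [simp]:
  "\<ominus>\<^bsub>free_algebra\<^esub> p = - (p :: ('x, 'k::field) free_alg)"
proof -
  interpret ring "free_algebra :: ('x, 'k) free_alg ring" by (rule ring_free_algebra)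
  show ?thesis by (rule minus_equality) simp_all
qed

lemma ideal_free_algebraI:
  assumes "0 \<in> J" and add: "\<And>p q. p \<in> J \<Longrightarrow> q \<in> J \<Longrightarrow> p + q \<in> J"
    and left: "\<And>p q. p \<in> J \<Longrightarrow> q * p \<in> J" and right: "\<And>p q. p \<in> J \<Longrightarrow> p * q \<in> J"
  shows "ideal J free_algebra"
proof (rule idealI[OF ring_free_algebra])
  have "- p \<in> J" if "p \<in> J" for p using left[OF that, of "- 1"] by simp
  then have "inv\<^bsub>add_monoid free_algebra\<^esub> p \<in> J" if "p \<in> J" for p
    using a_inv_free_algebra[of p] that unfolding a_inv_def by metis
  then show "subgroup J (add_monoid free_algebra)"
    using assms(1) add
    by (intro group.subgroupI[OF abelian_group.a_group[OF ring.is_abelian_group[OF ring_free_algebra]]])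
      auto
qed (simp_all add: left right)

lemma H4n_ideal_ideal: "ideal (H4n_ideal n \<omega>) free_algebra"
  unfolding H4n_ideal_def by (rule ring.genideal_ideal[OF ring_free_algebra]) simp

lemma H4n_ideal_minimal:
  assumes "ideal J free_algebra" "H4n_relators n \<omega> \<subseteq> J"
  shows "H4n_ideal n \<omega> \<subseteq> J"
  unfolding H4n_ideal_def by (rule ring.genideal_minimal[OF ring_free_algebra assms])

lemma H4n_relator_in_ideal: "p \<in> H4n_relators n \<omega> \<Longrightarrow> p \<in> H4n_ideal n \<omega>"
  unfolding H4n_ideal_def using ring.genideal_self[OF ring_free_algebra, of "H4n_relators n \<omega>"] by auto

lemma H4n_ideal_0 [simp]: "0 \<in> H4n_ideal n \<omega>"
  using additive_subgroup.zero_closed[OF ideal.axioms(1)[OF H4n_ideal_ideal]] by simp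

lemma H4n_ideal_add: "p \<in> H4n_ideal n \<omega> \<Longrightarrow> q \<in> H4n_ideal n \<omega> \<Longrightarrow> p + q \<in> H4n_ideal n \<omega>"
  using additive_subgroup.a_closed[OF ideal.axioms(1)[OF H4n_ideal_ideal]] by simp

lemma H4n_ideal_left: "p \<in> H4n_ideal n \<omega> \<Longrightarrow> q * p \<in> H4n_ideal n \<omega>"
  using ideal.I_l_closed[OF H4n_ideal_ideal] by simp

lemma H4n_ideal_right: "p \<in> H4n_ideal n \<omega> \<Longrightarrow> p * q \<in> H4n_ideal n \<omega>"
  using ideal.I_r_closed[OF H4n_ideal_ideal] by simp

lemma H4n_ideal_minus: "p \<in> H4n_ideal n \<omega> \<Longrightarrow> - p \<in> H4n_ideal n \<omega>"
  using H4n_ideal_left[of p n \<omega> "- 1"] by simp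

section \<open>Coordinates\<close>

text \<open>
  The scalar that appears when a word is sorted into the form \<open>x\<^sup>j g\<^sup>i c\<^sup>k\<close>: a letter \<open>g\<close> or \<open>c\<close> that
  moves to the right past \<open>x\<^sup>j\<close> contributes \<open>(-1)\<^sup>j\<close> or \<open>\<omega>\<^sup>j\<close>. The value is zero unless the word has
  exactly \<open>j\<close> letters \<open>x\<close>, and always for \<open>j \<ge> 2\<close>, as \<open>x\<^sup>2 = 0\<close>. Leaving \<open>j\<close> unbounded saves case
  distinctions in the formula for the comultiplication.
\<close>

fun mono_coeff :: "'k::field \<Rightarrow> nat \<Rightarrow> gen list \<Rightarrow> 'k"
  where
    "mono_coeff \<omega> j [] = (if j = 0 then 1 else 0)"
  | "mono_coeff \<omega> j (Gen_g # w) = (- 1) ^ j * mono_coeff \<omega> j w"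
  | "mono_coeff \<omega> j (Gen_c # w) = \<omega> ^ j * mono_coeff \<omega> j w"
  | "mono_coeff \<omega> j (Gen_x # w) = (if j = 1 then mono_coeff \<omega> 0 w else 0)"

text \<open>
  The exponents \<open>i\<close> and \<open>k\<close> are integers that matter only modulo \<open>2\<close> and modulo \<open>n\<close>. In this way
  multiplication by a generator shifts an index, without a wrap-around.
\<close>

definition word_coord :: "nat \<Rightarrow> 'k::field \<Rightarrow> nat \<Rightarrow> int \<Rightarrow> int \<Rightarrow> gen word \<Rightarrow> 'k"
  where "word_coord n \<omega> j i k w =
    (if even (int (count_list (letters w) Gen_g) - i) \<and> int n dvd int (count_list (letters w) Gen_c) - k
     then mono_coeff \<omega> j (letters w) else 0)"

definition coord :: "nat \<Rightarrow> 'k::field \<Rightarrow> nat \<Rightarrow> int \<Rightarrow> int \<Rightarrow> (gen, 'k) free_alg \<Rightarrow> 'k"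
  where "coord n \<omega> j i k p =
    (\<Sum>w\<in>Poly_Mapping.keys p. Poly_Mapping.lookup p w * word_coord n \<omega> j i k w)"

lemma additive_coord: "additive (coord n \<omega> j i k)"
  unfolding coord_def by (rule additive_keys_sum) (simp add: additive_def distrib_right)

lemmas coord_add = additive.add[OF additive_coord]
lemmas coord_minus = additive.minus[OF additive_coord]
lemmas coord_diff = additive.diff[OF additive_coord]
lemmas coord_sum = additive.sum[OF additive_coord]
lemmas coord_0 = additive.zero[OF additive_coord]

lemma coord_single:
  "coord n \<omega> j i k (Poly_Mapping.single w r) = r * word_coord n \<omega> j i k w"
  by (cases "r = 0") (simp_all add: coord_def)

lemma coord_scalar_mult: "coord n \<omega> j i k (scalar r * p) = r * coord n \<omega> j i k p"
  unfolding scalar_def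
  by (induction p rule: poly_mapping_induct)
    (simp_all add: mult_single distrib_left coord_add coord_single mult.assoc)

lemma coord_scalar:
  "coord n \<omega> j i k (scalar r) = (if j = 0 \<and> even i \<and> int n dvd k then r else 0)"
  by (simp add: scalar_def coord_single word_coord_def zero_word_def)

lemma coord_1: "coord n \<omega> j i k 1 = (if j = 0 \<and> even i \<and> int n dvd k then 1 else 0)"
  using coord_scalar[of n \<omega> j i k 1] by simp

lemma coord_g_mult: "coord n \<omega> j i k (generator Gen_g * p) = (- 1) ^ j * coord n \<omega> j (i - 1) k p"
proof (induction p rule: poly_mapping_induct)
  case (single w r)
  have "even (int (Suc m) - i) \<longleftrightarrow> even (int m - (i - 1))" for m by presburger
  then show ?case
    by (simp add: generator_def mult_single coord_single word_coord_def plus_word_def del: of_nat_Suc)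
qed (simp add: distrib_left coord_add)

lemma coord_c_mult: "coord n \<omega> j i k (generator Gen_c * p) = \<omega> ^ j * coord n \<omega> j i (k - 1) p"
proof (induction p rule: poly_mapping_induct)
  case (single w r)
  show ?case
    by (simp add: generator_def mult_single coord_single word_coord_def plus_word_def
        diff_diff_eq2 add.commute)
qed (simp add: distrib_left coord_add)

lemma coord_x_mult:
  "coord n \<omega> j i k (generator Gen_x * p) = (if j = 1 then coord n \<omega> 0 i k p else 0)"
proof (induction p rule: poly_mapping_induct)
  case (single w r)
  then show ?case
    by (simp add: generator_def mult_single coord_single word_coord_def plus_word_def)
qed (simp add: distrib_left coord_add)

lemma coord_g_power_mult:
  "coord n \<omega> j i k (generator Gen_g ^ m * p) = (- 1) ^ (j * m) * coord n \<omega> j (i - int m) k p"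
proof (induction m arbitrary: i)
  case (Suc m)
  then show ?case
    by (simp add: mult.assoc coord_g_mult power_add) (simp add: diff_diff_eq add.commute)
qed simp

lemma coord_c_power_mult:
  "coord n \<omega> j i k (generator Gen_c ^ m * p) = \<omega> ^ (j * m) * coord n \<omega> j i (k - int m) p"
proof (induction m arbitrary: k)
  case (Suc m)
  then show ?case
    by (simp add: mult.assoc coord_c_mult power_add) (simp add: diff_diff_eq add.commute)
qed simp

lemmas coord_mult_simps =
  coord_g_mult coord_c_mult coord_x_mult coord_g_power_mult coord_c_power_mult

lemmas coord_g = coord_g_mult[where p = 1, simplified mult_1_right]
lemmas coord_c = coord_c_mult[where p = 1, simplified mult_1_right]
lemmas coord_x = coord_x_mult[where p = 1, simplified mult_1_right]
lemmas coord_g_power = coord_g_power_mult[where p = 1, simplified mult_1_right]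
lemmas coord_c_power = coord_c_power_mult[where p = 1, simplified mult_1_right]

lemmas coord_simps = coord_mult_simps coord_scalar_mult coord_scalar coord_1
  coord_g coord_c coord_x coord_g_power coord_c_power coord_add coord_minus coord_diff coord_0

lemma coord_cong:
  assumes "even (i - i')" "int n dvd k - k'"
  shows "coord n \<omega> j i k p = coord n \<omega> j i' k' p"
proof -
  have "even (m - i) \<longleftrightarrow> even (m - i')" for m
    using assms(1) by auto
  moreover have "int n dvd m - k \<longleftrightarrow> int n dvd m - k'" for m
    using assms(2) dvd_add_left_iff[of "int n" "k - k'" "m - k"] by (simp add: algebra_simps)
  ultimately show ?thesis by (simp only: coord_def word_coord_def)
qed

text \<open>
  The elements \<open>p\<close> such that the coordinates of every \<open>p q\<close> vanish form a two-sided ideal, because the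
  coordinates of \<open>a q\<close>, for a generator \<open>a\<close>, are scalar multiples of coordinates of \<open>q\<close>. It contains
  the relators by the multiplication rules above; for \<open>c\<^sup>n - 1\<close> this uses \<open>\<omega>\<^sup>n = 1\<close>.
\<close>

lemma coord_ideal:
  assumes \<omega>: "\<omega> ^ n = 1" and p: "p \<in> H4n_ideal n \<omega>"
  shows "coord n \<omega> j i k p = 0"
proof -
  let ?J = "{p. \<forall>j i k q. coord n \<omega> j i k (p * q) = 0}"
  have "H4n_ideal n \<omega> \<subseteq> ?J"
  proof (rule H4n_ideal_minimal)
    show "ideal ?J free_algebra"
    proof (rule ideal_free_algebraI)
      fix p r assume p: "p \<in> ?J"
      show "r * p \<in> ?J"
      proof (induction r rule: free_alg_induct)
        case (generator a r)
        then show ?case by (cases a) (simp_all add: mult.assoc coord_mult_simps)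
      qed (use p in \<open>simp_all add: coord_scalar_mult distrib_right coord_add mult.assoc\<close>)
    qed (simp_all add: coord_0 coord_add distrib_right mult.assoc)
    have "coord n \<omega> j (i - 2) k q = coord n \<omega> j i k q"
      "coord n \<omega> j i (k - int n) q = coord n \<omega> j i k q" for j i k q
      by (rule coord_cong; simp)+
    then show "H4n_relators n \<omega> \<subseteq> ?J"
      using \<omega>
      by (auto simp: H4n_relators_def left_diff_distrib distrib_right coord_diff coord_minus coord_add mult.assoc
          power2_eq_square coord_mult_simps coord_scalar_mult power_mult power_mult_distrib
          mult.commute[of j n for j])
  qed
  then have "coord n \<omega> j i k (p * 1) = 0" using p by blast
  then show ?thesis by simp
qed


section \<open>The monomials span the algebra\<close>

definition H4n_cong :: "nat \<Rightarrow> 'k::field \<Rightarrow> (gen, 'k) free_alg \<Rightarrow> (gen, 'k) free_alg \<Rightarrow> bool"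
  where "H4n_cong n \<omega> p q \<longleftrightarrow> p - q \<in> H4n_ideal n \<omega>"

lemma H4n_cong_refl [simp]: "H4n_cong n \<omega> p p"
  by (simp add: H4n_cong_def)

lemma H4n_cong_trans [trans]: "H4n_cong n \<omega> p q \<Longrightarrow> H4n_cong n \<omega> q r \<Longrightarrow> H4n_cong n \<omega> p r"
  unfolding H4n_cong_def using H4n_ideal_add[of "p - q" n \<omega> "q - r"] by simp

lemma H4n_cong_add: "H4n_cong n \<omega> p q \<Longrightarrow> H4n_cong n \<omega> p' q' \<Longrightarrow> H4n_cong n \<omega> (p + p') (q + q')"
  unfolding H4n_cong_def using H4n_ideal_add[of "p - q" n \<omega> "p' - q'"] by (simp add: algebra_simps)

lemma H4n_cong_mult_left: "H4n_cong n \<omega> p q \<Longrightarrow> H4n_cong n \<omega> (r * p) (r * q)"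
  unfolding H4n_cong_def using H4n_ideal_left[of "p - q" n \<omega> r] by (simp add: right_diff_distrib)

lemma H4n_cong_mult_right: "H4n_cong n \<omega> p q \<Longrightarrow> H4n_cong n \<omega> (p * r) (q * r)"
  unfolding H4n_cong_def using H4n_ideal_right[of "p - q" n \<omega> r] by (simp add: left_diff_distrib)

lemma H4n_cong_relations:
  shows "H4n_cong n \<omega> (fg ^ 2) 1" "H4n_cong n \<omega> (fc ^ n) 1" "H4n_cong n \<omega> (fx * fx) 0"
    "H4n_cong n \<omega> (fg * fx) (scalar (- 1) * (fx * fg))" "H4n_cong n \<omega> (fc * fg) (fg * fc)"
    "H4n_cong n \<omega> (fc * fx) (scalar \<omega> * (fx * fc))"
proof -
  have "fx * fg - (- (fg * fx)) \<in> H4n_ideal n \<omega>"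
    by (rule H4n_relator_in_ideal) (simp add: H4n_relators_def)
  then show "H4n_cong n \<omega> (fg * fx) (scalar (- 1) * (fx * fg))"
    by (simp add: H4n_cong_def additive.minus[OF additive_scalar] add.commute)
qed (unfold H4n_cong_def; simp add: H4n_relators_def power2_eq_square H4n_relator_in_ideal)+

lemma H4n_cong_power_1:
  assumes "H4n_cong n \<omega> (p ^ m) 1"
  shows "H4n_cong n \<omega> (p ^ i) (p ^ (i mod m))"
proof -
  have "H4n_cong n \<omega> ((p ^ m) ^ d * q) q" for d q
  proof (induction d)
    case (Suc d)
    have "H4n_cong n \<omega> (p ^ m * ((p ^ m) ^ d * q)) (1 * ((p ^ m) ^ d * q))"
      by (rule H4n_cong_mult_right[OF assms])
    then show ?case using H4n_cong_trans[OF _ Suc] by (simp add: mult.assoc)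
  qed simp
  from this[of "i div m" "p ^ (i mod m)"] show ?thesis
    by (simp flip: power_mult power_add)
qed

definition basis_mono :: "nat \<Rightarrow> nat \<Rightarrow> nat \<Rightarrow> (gen, 'k::field) free_alg"
  where "basis_mono j i k = fx ^ j * (fg ^ i * fc ^ k)"

lemma H4n_cong_fc_fg_power: "H4n_cong n \<omega> (fc * fg ^ i) (fg ^ i * fc)"
proof (induction i)
  case (Suc i)
  have "H4n_cong n \<omega> (fc * fg * fg ^ i) (fg * fc * fg ^ i)"
    by (intro H4n_cong_mult_right H4n_cong_relations)
  also have "fg * fc * fg ^ i = fg * (fc * fg ^ i)" by (simp add: mult.assoc)
  also have "H4n_cong n \<omega> (fg * (fc * fg ^ i)) (fg * (fg ^ i * fc))"
    by (rule H4n_cong_mult_left[OF Suc])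
  finally show ?case by (simp add: mult.assoc)
qed simp

text \<open>
  The step that sorts a word: a generator in front of a monomial \<open>x\<^sup>j g\<^sup>i c\<^sup>k\<close> yields a multiple of
  another such monomial, which is zero for a second \<open>x\<close>.
\<close>

lemma H4n_cong_generator_basis_mono:
  assumes "j < 2"
  shows "\<exists>r j' i' k'. j' < 2 \<and>
    H4n_cong n \<omega> (generator a * basis_mono j i k) (scalar r * basis_mono j' i' k')"
proof (cases "a = Gen_x \<or> j = 0")
  case True
  then consider "a = Gen_x" "j = 1" | "a = Gen_x" "j = 0" | "a = Gen_g" "j = 0" | "a = Gen_c" "j = 0"
    using assms by (cases a) (auto simp: less_2_cases_iff)
  then show ?thesis
  proof cases
    case 1
    have "H4n_cong n \<omega> (fx * fx * (fg ^ i * fc ^ k)) (0 * (fg ^ i * fc ^ k))"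
      by (intro H4n_cong_mult_right H4n_cong_relations)
    with 1 show ?thesis
      by (intro exI[of _ 0] exI[of _ "0::nat"]) (simp add: basis_mono_def mult.assoc)
  next
    case 2
    then show ?thesis
      by (intro exI[of _ 1] exI[of _ "1::nat"] exI[of _ i] exI[of _ k]) (simp add: basis_mono_def)
  next
    case 3
    then show ?thesis
      by (intro exI[of _ 1] exI[of _ "0::nat"] exI[of _ "Suc i"] exI[of _ k])
        (simp add: basis_mono_def mult.assoc)
  next
    case 4
    have "H4n_cong n \<omega> (fc * fg ^ i * fc ^ k) (fg ^ i * fc * fc ^ k)"
      by (intro H4n_cong_mult_right H4n_cong_fc_fg_power)
    with 4 show ?thesis
      by (intro exI[of _ 1] exI[of _ "0::nat"] exI[of _ i] exI[of _ "Suc k"])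
        (simp add: basis_mono_def mult.assoc)
  qed
next
  case False
  then have j: "j = 1" using assms by simp
  consider "a = Gen_g" | "a = Gen_c" using False by (cases a) auto
  then show ?thesis
  proof cases
    case 1
    have "H4n_cong n \<omega> (fg * fx * (fg ^ i * fc ^ k)) (scalar (- 1) * (fx * fg) * (fg ^ i * fc ^ k))"
      by (intro H4n_cong_mult_right H4n_cong_relations)
    with 1 j show ?thesis
      by (intro exI[of _ "- 1"] exI[of _ "1::nat"] exI[of _ "Suc i"] exI[of _ k])
        (simp add: basis_mono_def mult.assoc)
  next
    case 2
    have "H4n_cong n \<omega> (fc * fx * (fg ^ i * fc ^ k)) (scalar \<omega> * (fx * fc) * (fg ^ i * fc ^ k))"
      by (intro H4n_cong_mult_right H4n_cong_relations)
    also have "scalar \<omega> * (fx * fc) * (fg ^ i * fc ^ k) = scalar \<omega> * fx * ((fc * fg ^ i) * fc ^ k)"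
      by (simp add: mult.assoc)
    also have "H4n_cong n \<omega> \<dots> (scalar \<omega> * fx * ((fg ^ i * fc) * fc ^ k))"
      by (intro H4n_cong_mult_left H4n_cong_mult_right H4n_cong_fc_fg_power)
    finally show ?thesis using 2 j
      by (intro exI[of _ \<omega>] exI[of _ "1::nat"] exI[of _ i] exI[of _ "Suc k"])
        (simp add: basis_mono_def mult.assoc)
  qed
qed

lemma H4n_cong_word_basis_mono:
  "\<exists>r j i k. j < 2 \<and> H4n_cong n \<omega> (Poly_Mapping.single (Word w) 1) (scalar r * basis_mono j i k)"
proof (induction w)
  case Nil
  show ?case
    by (intro exI[of _ 1] exI[of _ "0::nat"]) (simp add: single_Word_Nil basis_mono_def)
next
  case (Cons a w)
  then obtain r j i k where j: "j < 2"
    and w: "H4n_cong n \<omega> (Poly_Mapping.single (Word w) 1) (scalar r * basis_mono j i k)" by blast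
  from H4n_cong_generator_basis_mono[OF j] obtain s j' i' k' where "j' < 2"
    and a: "H4n_cong n \<omega> (generator a * basis_mono j i k) (scalar s * basis_mono j' i' k')" by blast
  moreover have scalar_left_commute:
    "generator a * (scalar r * basis_mono j i k) = scalar r * (generator a * basis_mono j i k)"
    using arg_cong[OF scalar_commute[of r "generator a"], of "\<lambda>z. z * basis_mono j i k"]
    by (simp add: mult.assoc)
  moreover have "H4n_cong n \<omega> (Poly_Mapping.single (Word (a # w)) 1) (generator a * (scalar r * basis_mono j i k))"
    unfolding single_Word_Cons by (rule H4n_cong_mult_left[OF w])
  then have "H4n_cong n \<omega> (Poly_Mapping.single (Word (a # w)) 1) (scalar (r * s) * basis_mono j' i' k')"
    using H4n_cong_trans[OF _ H4n_cong_mult_left[OF a, of "scalar r"]]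
    by (simp add: scalar_mult mult.assoc scalar_left_commute)
  ultimately show ?case by blast
qed

lemma H4n_cong_basis_mono_mod:
  "H4n_cong n \<omega> (basis_mono j i k) (basis_mono j (i mod 2) (k mod n))"
proof -
  have "H4n_cong n \<omega> (fx ^ j * fg ^ i * fc ^ k) (fx ^ j * fg ^ i * fc ^ (k mod n))"
    by (intro H4n_cong_mult_left H4n_cong_power_1 H4n_cong_relations)
  also have "\<dots> = fx ^ j * (fg ^ i * fc ^ (k mod n))"
    by (simp add: mult.assoc)
  also have "H4n_cong n \<omega> \<dots> (fx ^ j * (fg ^ (i mod 2) * fc ^ (k mod n)))"
    by (intro H4n_cong_mult_left H4n_cong_mult_right H4n_cong_power_1 H4n_cong_relations)
  finally show ?thesis
    by (simp add: basis_mono_def mult.assoc)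
qed

lemma H4n_spanning:
  assumes n: "n > 0"
  shows "\<exists>a. H4n_cong n \<omega> p (\<Sum>(j, i, k)\<in>{..<2} \<times> {..<2} \<times> {..<n}. scalar (a j i k) * basis_mono j i k)"
    (is "\<exists>a. H4n_cong n \<omega> p (?S a)")
proof (induction p rule: poly_mapping_induct)
  case (single u c)
  obtain r j i k where j: "j < 2"
    and w: "H4n_cong n \<omega> (Poly_Mapping.single u 1) (scalar r * basis_mono j i k)"
    using H4n_cong_word_basis_mono[of n \<omega> "letters u"] by auto
  have "H4n_cong n \<omega> (scalar c * Poly_Mapping.single u 1) (scalar c * (scalar r * basis_mono j i k))"
    by (rule H4n_cong_mult_left[OF w])
  also have "H4n_cong n \<omega> \<dots> (scalar c * (scalar r * basis_mono j (i mod 2) (k mod n)))"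
    by (intro H4n_cong_mult_left H4n_cong_basis_mono_mod)
  also have "\<dots> = ?S (\<lambda>j' i' k'. if (j', i', k') = (j, i mod 2, k mod n) then c * r else 0)"
  proof -
    have "?S (\<lambda>j' i' k'. if (j', i', k') = (j, i mod 2, k mod n) then c * r else 0) =
      (\<Sum>z\<in>{..<2} \<times> {..<2} \<times> {..<n}. if z = (j, i mod 2, k mod n)
         then scalar (c * r) * basis_mono j (i mod 2) (k mod n) else 0)"
    proof (rule sum.cong[OF refl])
      fix z :: "nat \<times> nat \<times> nat"
      show "(case z of (j', i', k') \<Rightarrow>
          scalar (if (j', i', k') = (j, i mod 2, k mod n) then c * r else 0) * basis_mono j' i' k') =
        (if z = (j, i mod 2, k mod n) then scalar (c * r) * basis_mono j (i mod 2) (k mod n) else 0)"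
        by (cases z) simp
    qed
    then show ?thesis using j n by (simp add: sum.delta scalar_mult mult.assoc)
  qed
  finally show ?case by (auto simp: scalar_def mult_single)
next
  case (add p q)
  then obtain a b where "H4n_cong n \<omega> p (?S a)" "H4n_cong n \<omega> q (?S b)" by blast
  then have "H4n_cong n \<omega> (p + q) (?S a + ?S b)" by (rule H4n_cong_add)
  also have "?S a + ?S b = ?S (\<lambda>j i k. a j i k + b j i k)"
    by (simp add: sum.distrib[symmetric] case_prod_unfold additive.add[OF additive_scalar] distrib_right)
  finally show ?case by (rule exI[where x = "\<lambda>j i k. a j i k + b j i k"])
qed

lemma coord_basis_mono:
  assumes "j' < 2"
  shows "coord n \<omega> j i k (basis_mono j' i' k') =
    (if j = j' \<and> even (i - int i') \<and> int n dvd k - int k' then 1 else 0)"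
  using assms unfolding less_2_cases_iff basis_mono_def by (auto simp: coord_simps split: if_splits)

text \<open>
  This is the linear independence of the monomials: the coordinates vanish on the ideal and are the
  dual basis on the monomials, so the coefficients in a representation of \<open>p\<close> by \<open>H4n_spanning\<close> are
  the coordinates of \<open>p\<close>.
\<close>

lemma coord_eq_0_iff:
  assumes \<omega>: "\<omega> ^ n = 1" and n: "n > 0"
  shows "p \<in> H4n_ideal n \<omega> \<longleftrightarrow> (\<forall>j i k. coord n \<omega> j i k p = 0)"
proof (intro iffI allI)
  assume p: "\<forall>j i k. coord n \<omega> j i k p = 0"
  let ?Z = "{..<2::nat} \<times> {..<2::nat} \<times> {..<n}"
  obtain a where a: "H4n_cong n \<omega> p (\<Sum>(j, i, k)\<in>?Z. scalar (a j i k) * basis_mono j i k)"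
    (is "H4n_cong n \<omega> p ?S")
    using H4n_spanning[OF n] by blast
  have "a j i k = 0" if z: "(j, i, k) \<in> ?Z" for j i k
  proof -
    have "coord n \<omega> j (int i) (int k) ?S =
      (\<Sum>(j', i', k')\<in>?Z. if (j', i', k') = (j, i, k) then a j i k else 0)"
      unfolding coord_sum
    proof (rule sum.cong)
      fix z' assume "z' \<in> ?Z"
      moreover obtain j' i' k' where [simp]: "z' = (j', i', k')" by (cases z')
      moreover have "even (int i - int i') \<longleftrightarrow> i = i'" if "i' < 2"
        using that z by (auto simp: less_2_cases_iff)
      moreover have "int n dvd int k - int k' \<longleftrightarrow> k = k'" if "k' < n"
        using that z mod_eq_dvd_iff[of "int k" "int n" "int k'"] by auto
      ultimately show "coord n \<omega> j (int i) (int k) (case z' of (j, i, k) \<Rightarrow> scalar (a j i k) * basis_mono j i k)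
        = (case z' of (j', i', k') \<Rightarrow> if (j', i', k') = (j, i, k) then a j i k else 0)"
        by (auto simp: coord_scalar_mult coord_basis_mono)
    qed simp
    also have "\<dots> = (\<Sum>z'\<in>?Z. if z' = (j, i, k) then a j i k else 0)"
      by (rule sum.cong[OF refl]) (simp only: case_prod_beta' prod.collapse)
    also have "\<dots> = a j i k" using z by (simp add: sum.delta)
    finally show ?thesis
      using coord_ideal[OF \<omega> a[unfolded H4n_cong_def], of j "int i" "int k"] p
      by (simp add: coord_diff)
  qed
  then have "?S = (\<Sum>z\<in>?Z. 0)" by (intro sum.cong) auto
  then show "p \<in> H4n_ideal n \<omega>" using a by (simp add: H4n_cong_def)
qed (rule coord_ideal[OF \<omega>])


section \<open>Maps and functionals on tensor products\<close>

lemma the_elem_image_const: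
  assumes "x \<in> A" "\<And>y. y \<in> A \<Longrightarrow> F y = F x"
  shows "the_elem (F ` A) = F x"
proof -
  have "F ` A = {F x}" using assms by blast
  then show ?thesis by simp
qed

definition tensor_cong ::
    "('k::field, 'v, 'm) module_scheme \<Rightarrow> ('k, 'w, 'n) module_scheme
      \<Rightarrow> ('v \<times> 'w \<Rightarrow>\<^sub>0 'k) \<Rightarrow> ('v \<times> 'w \<Rightarrow>\<^sub>0 'k) \<Rightarrow> bool"
  where "tensor_cong V W p q \<longleftrightarrow> p - q \<in> formal.span (tensor_rels V W)"

lemma tensor_cong_refl [simp]: "tensor_cong V W p p"
  by (simp add: tensor_cong_def formal.span_zero)

lemma tensor_cong_sym: "tensor_cong V W p q \<Longrightarrow> tensor_cong V W q p"
  unfolding tensor_cong_def using formal.span_neg[of "p - q"] by simp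

lemma tensor_cong_trans [trans]:
  "tensor_cong V W p q \<Longrightarrow> tensor_cong V W q r \<Longrightarrow> tensor_cong V W p r"
  unfolding tensor_cong_def using formal.span_add[of "p - q" _ "q - r"] by simp

lemma tensor_cong_add:
  "tensor_cong V W p q \<Longrightarrow> tensor_cong V W p' q' \<Longrightarrow> tensor_cong V W (p + p') (q + q')"
  unfolding tensor_cong_def using formal.span_add[of "p - q" _ "p' - q'"] by (simp add: algebra_simps)

lemma tensor_cong_fscale:
  "tensor_cong V W p q \<Longrightarrow> tensor_cong V W (fscale r p) (fscale r q)"
  unfolding tensor_cong_def using formal.span_scale[of "p - q" _ r]
  by (simp add: additive.diff[OF additive_fscale])

lemma tensor_cong_relation: "p - q \<in> tensor_rels V W \<Longrightarrow> tensor_cong V W p q"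
  unfolding tensor_cong_def by (rule formal.span_base)

lemma tensor_cong_add_left:
  assumes "a \<in> carrier V" "b \<in> carrier V" "d \<in> carrier W"
  shows "tensor_cong V W (Poly_Mapping.single (a \<oplus>\<^bsub>V\<^esub> b, d) 1)
    (Poly_Mapping.single (a, d) 1 + Poly_Mapping.single (b, d) 1)"
  by (rule tensor_cong_relation) (use assms in \<open>unfold tensor_rels_def diff_diff_eq, blast\<close>)

lemma tensor_cong_add_right:
  assumes "a \<in> carrier V" "d \<in> carrier W" "e \<in> carrier W"
  shows "tensor_cong V W (Poly_Mapping.single (a, d \<oplus>\<^bsub>W\<^esub> e) 1)
    (Poly_Mapping.single (a, d) 1 + Poly_Mapping.single (a, e) 1)"
  by (rule tensor_cong_relation) (use assms in \<open>unfold tensor_rels_def diff_diff_eq, blast\<close>)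

lemma tensor_cong_smult_left:
  assumes "a \<in> carrier V" "d \<in> carrier W"
  shows "tensor_cong V W (Poly_Mapping.single (r \<odot>\<^bsub>V\<^esub> a, d) 1) (Poly_Mapping.single (a, d) r)"
  by (rule tensor_cong_relation) (use assms in \<open>unfold tensor_rels_def, blast\<close>)

lemma tensor_cong_smult_right:
  assumes "a \<in> carrier V" "d \<in> carrier W"
  shows "tensor_cong V W (Poly_Mapping.single (a, r \<odot>\<^bsub>W\<^esub> d) 1) (Poly_Mapping.single (a, d) r)"
  by (rule tensor_cong_relation) (use assms in \<open>unfold tensor_rels_def, blast\<close>)

lemma tensor_rels_cases:
  assumes "p \<in> tensor_rels V W"
  obtains (add_left) a b d where "a \<in> carrier V" "b \<in> carrier V" "d \<in> carrier W"
      "p = Poly_Mapping.single (a \<oplus>\<^bsub>V\<^esub> b, d) 1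
        - (Poly_Mapping.single (a, d) 1 + Poly_Mapping.single (b, d) 1)"
    | (add_right) a d e where "a \<in> carrier V" "d \<in> carrier W" "e \<in> carrier W"
      "p = Poly_Mapping.single (a, d \<oplus>\<^bsub>W\<^esub> e) 1
        - (Poly_Mapping.single (a, d) 1 + Poly_Mapping.single (a, e) 1)"
    | (smult_left) r a d where "a \<in> carrier V" "d \<in> carrier W"
      "p = Poly_Mapping.single (r \<odot>\<^bsub>V\<^esub> a, d) 1 - Poly_Mapping.single (a, d) r"
    | (smult_right) r a d where "a \<in> carrier V" "d \<in> carrier W"
      "p = Poly_Mapping.single (a, r \<odot>\<^bsub>W\<^esub> d) 1 - Poly_Mapping.single (a, d) r"
  using assms unfolding tensor_rels_def diff_diff_eq Un_iff mem_Collect_eq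
  by (elim disjE exE conjE)
    (erule (3) that(1), erule (3) that(2), erule (2) that(3), erule (2) that(4))

lemma tensor_class_eq_iff:
  "tensor_class V W p = tensor_class V W q \<longleftrightarrow> tensor_cong V W p q"
proof
  assume "tensor_class V W p = tensor_class V W q"
  moreover have "p \<in> tensor_class V W p" by (simp add: tensor_class_def formal.span_zero)
  ultimately show "tensor_cong V W p q" by (simp add: tensor_class_def tensor_cong_def)
next
  assume "tensor_cong V W p q"
  then show "tensor_class V W p = tensor_class V W q"
    unfolding tensor_class_def tensor_cong_def[symmetric]
    by (intro Collect_cong iffI) (metis tensor_cong_trans tensor_cong_sym)+
qed

definition carrier_linear ::
    "('k::field, 'v, 'm) module_scheme \<Rightarrow> ('k, 'w, 'n) module_scheme \<Rightarrow> ('v \<Rightarrow> 'w) \<Rightarrow> bool"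
  where "carrier_linear V W f \<longleftrightarrow> f \<in> carrier V \<rightarrow> carrier W \<and>
    (\<forall>a\<in>carrier V. \<forall>b\<in>carrier V. f (a \<oplus>\<^bsub>V\<^esub> b) = f a \<oplus>\<^bsub>W\<^esub> f b) \<and>
    (\<forall>r. \<forall>a\<in>carrier V. f (r \<odot>\<^bsub>V\<^esub> a) = r \<odot>\<^bsub>W\<^esub> f a)"

lemma carrier_linearD:
  assumes "carrier_linear V W f" "a \<in> carrier V"
  shows "f a \<in> carrier W" "b \<in> carrier V \<Longrightarrow> f (a \<oplus>\<^bsub>V\<^esub> b) = f a \<oplus>\<^bsub>W\<^esub> f b"
    "f (r \<odot>\<^bsub>V\<^esub> a) = r \<odot>\<^bsub>W\<^esub> f a"
  using assms unfolding carrier_linear_def by blast+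

lemma tensor_cong_formal_map:
  assumes f: "carrier_linear V V' f" and h: "carrier_linear W W' h" and "tensor_cong V W p q"
  shows "tensor_cong V' W' (formal_map (map_prod f h) p) (formal_map (map_prod f h) q)"
proof -
  have "formal_map (map_prod f h) s \<in> formal.span (tensor_rels V' W')"
    if "s \<in> formal.span (tensor_rels V W)" for s
    using that
  proof (induction s rule: formal.span_induct)
    case base
    show ?case
      by (rule formal.subspaceI)
        (auto simp: formal_map_add formal_map_fscale additive.zero[OF additive_formal_map]
          intro: formal.span_zero formal.span_add formal.span_scale)
  next
    case (step s)
    note f' = carrier_linearD[OF f] and h' = carrier_linearD[OF h]
    from step show ?case
    proof (cases rule: tensor_rels_cases)
      case (add_left a b d)
      show ?thesis
        using tensor_cong_add_left[of "f a" V' "f b" "h d" W'] add_left f' h'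
        by (simp add: formal_map_diff formal_map_add tensor_cong_def)
    next
      case (add_right a d e)
      show ?thesis
        using tensor_cong_add_right[of "f a" V' "h d" W' "h e"] add_right f' h'
        by (simp add: formal_map_diff formal_map_add tensor_cong_def)
    next
      case (smult_left r a d)
      show ?thesis
        using tensor_cong_smult_left[of "f a" V' "h d" W' r] smult_left f' h'
        by (simp add: formal_map_diff formal_map_add tensor_cong_def)
    next
      case (smult_right r a d)
      show ?thesis
        using tensor_cong_smult_right[of "f a" V' "h d" W' r] smult_right f' h'
        by (simp add: formal_map_diff formal_map_add tensor_cong_def)
    qed
  qed
  then show ?thesis
    using assms(3) by (simp add: tensor_cong_def formal_map_diff[symmetric])
qed

lemma tensor_map_class:
  assumes "carrier_linear V V' f" "carrier_linear W W' h"
  shows "tensor_map V' W' f h (tensor_class V W p) = tensor_class V' W' (formal_map (map_prod f h) p)"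
  unfolding tensor_map_def
proof (rule the_elem_image_const)
  show "p \<in> tensor_class V W p" by (simp add: tensor_class_def formal.span_zero)
  fix q assume "q \<in> tensor_class V W p"
  then have "tensor_cong V W q p" by (simp add: tensor_class_def tensor_cong_def)
  then show "tensor_class V' W' (formal_map (map_prod f h) q) =
    tensor_class V' W' (formal_map (map_prod f h) p)"
    unfolding tensor_class_eq_iff by (rule tensor_cong_formal_map[OF assms])
qed

definition tensor_eval :: "('v \<Rightarrow> 'k) \<Rightarrow> ('w \<Rightarrow> 'k) \<Rightarrow> ('v \<times> 'w \<Rightarrow>\<^sub>0 'k::field) \<Rightarrow> 'k"
  where "tensor_eval \<phi> \<psi> p =
    (\<Sum>z\<in>Poly_Mapping.keys p. Poly_Mapping.lookup p z * (\<phi> (fst z) * \<psi> (snd z)))"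

lemma additive_tensor_eval: "additive (tensor_eval \<phi> \<psi>)"
  unfolding tensor_eval_def by (rule additive_keys_sum) (simp add: additive_def distrib_right)

lemmas tensor_eval_add = additive.add[OF additive_tensor_eval]
lemmas tensor_eval_diff = additive.diff[OF additive_tensor_eval]

lemma tensor_eval_single [simp]:
  "tensor_eval \<phi> \<psi> (Poly_Mapping.single (a, b) r) = r * (\<phi> a * \<psi> b)"
  by (cases "r = 0") (simp_all add: tensor_eval_def)

lemma tensor_eval_fscale: "tensor_eval \<phi> \<psi> (fscale r p) = r * tensor_eval \<phi> \<psi> p"
proof (induction p rule: poly_mapping_induct)
  case (single z s)
  then show ?case by (cases z) (simp add: mult.assoc)
qed (simp add: tensor_eval_add formal.scale_right_distrib distrib_left)

definition carrier_functional :: "('k::field, 'v, 'm) module_scheme \<Rightarrow> ('v \<Rightarrow> 'k) \<Rightarrow> bool"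
  where "carrier_functional V \<phi> \<longleftrightarrow>
    (\<forall>a\<in>carrier V. \<forall>b\<in>carrier V. \<phi> (a \<oplus>\<^bsub>V\<^esub> b) = \<phi> a + \<phi> b) \<and>
    (\<forall>r. \<forall>a\<in>carrier V. \<phi> (r \<odot>\<^bsub>V\<^esub> a) = r * \<phi> a)"

lemma carrier_functionalD:
  assumes "carrier_functional V \<phi>" "a \<in> carrier V"
  shows "b \<in> carrier V \<Longrightarrow> \<phi> (a \<oplus>\<^bsub>V\<^esub> b) = \<phi> a + \<phi> b" "\<phi> (r \<odot>\<^bsub>V\<^esub> a) = r * \<phi> a"
  using assms unfolding carrier_functional_def by blast+

text \<open>
  Elements of a tensor product are told apart by pairs of linear functionals, since these are
  compatible with the bilinearity relations.
\<close>

lemma tensor_eval_cong: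
  assumes \<phi>: "carrier_functional V \<phi>" and \<psi>: "carrier_functional W \<psi>" and "tensor_cong V W p q"
  shows "tensor_eval \<phi> \<psi> p = tensor_eval \<phi> \<psi> q"
proof -
  have "tensor_eval \<phi> \<psi> s = 0" if "s \<in> formal.span (tensor_rels V W)" for s
    using that
  proof (induction s rule: formal.span_induct)
    case base
    show ?case
      by (rule formal.subspaceI)
        (auto simp: tensor_eval_add tensor_eval_fscale additive.zero[OF additive_tensor_eval])
  next
    case (step s)
    then show ?case
      by (cases rule: tensor_rels_cases)
        (simp_all add: carrier_functionalD[OF \<phi>] carrier_functionalD[OF \<psi>]
          tensor_eval_diff tensor_eval_add distrib_left distrib_right)
  qed
  then show ?thesis
    using assms(3) tensor_eval_diff[of \<phi> \<psi> p q] by (simp add: tensor_cong_def)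
qed


section \<open>The algebra structure on representatives\<close>

lemma H4n_class_eq: "H4n_class n \<omega> p = {q. H4n_cong n \<omega> q p}"
proof -
  have "H4n_class n \<omega> p = {h + p |h. h \<in> H4n_ideal n \<omega>}"
    by (auto simp: H4n_class_def a_r_coset_def')
  also have "\<dots> = {q. H4n_cong n \<omega> q p}"
    by (auto simp: H4n_cong_def intro!: exI[of _ "q - p" for q])
  finally show ?thesis .
qed

lemma H4n_cong_sym: "H4n_cong n \<omega> p q \<Longrightarrow> H4n_cong n \<omega> q p"
  unfolding H4n_cong_def using H4n_ideal_minus[of "p - q"] by simp

lemma H4n_class_eq_iff: "H4n_class n \<omega> p = H4n_class n \<omega> q \<longleftrightarrow> H4n_cong n \<omega> p q"
proof
  assume "H4n_class n \<omega> p = H4n_class n \<omega> q"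
  then show "H4n_cong n \<omega> p q" unfolding H4n_class_eq using H4n_cong_refl[of n \<omega> p] by blast
next
  assume "H4n_cong n \<omega> p q"
  then show "H4n_class n \<omega> p = H4n_class n \<omega> q"
    unfolding H4n_class_eq by (intro Collect_cong iffI) (metis H4n_cong_trans H4n_cong_sym)+
qed

lemma H4n_algebra_simps:
  "carrier (H4n_algebra n \<omega>) = range (H4n_class n \<omega>)"
  "H4n_class n \<omega> p \<otimes>\<^bsub>H4n_algebra n \<omega>\<^esub> H4n_class n \<omega> q = H4n_class n \<omega> (p * q)"
  "H4n_class n \<omega> p \<oplus>\<^bsub>H4n_algebra n \<omega>\<^esub> H4n_class n \<omega> q = H4n_class n \<omega> (p + q)"
  "\<one>\<^bsub>H4n_algebra n \<omega>\<^esub> = H4n_class n \<omega> 1"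
  "r \<odot>\<^bsub>H4n_algebra n \<omega>\<^esub> H4n_class n \<omega> p = H4n_class n \<omega> (scalar r * p)"
proof -
  interpret ideal "H4n_ideal n \<omega>" free_algebra by (rule H4n_ideal_ideal)
  show "carrier (H4n_algebra n \<omega>) = range (H4n_class n \<omega>)"
    by (auto simp: H4n_algebra_def ring.defs module.defs FactRing_def A_RCOSETS_def' H4n_class_def)
  show "H4n_class n \<omega> p \<otimes>\<^bsub>H4n_algebra n \<omega>\<^esub> H4n_class n \<omega> q = H4n_class n \<omega> (p * q)"
    using rcoset_mult_add[of p q]
    by (simp add: H4n_algebra_def ring.defs module.defs FactRing_def H4n_class_def)
  show "H4n_class n \<omega> p \<oplus>\<^bsub>H4n_algebra n \<omega>\<^esub> H4n_class n \<omega> q = H4n_class n \<omega> (p + q)"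
    using a_rcos_sum[of p q]
    by (simp add: H4n_algebra_def ring.defs module.defs FactRing_def H4n_class_def)
  show "\<one>\<^bsub>H4n_algebra n \<omega>\<^esub> = H4n_class n \<omega> 1"
    by (simp add: H4n_algebra_def ring.defs module.defs FactRing_def H4n_class_def)
  show "r \<odot>\<^bsub>H4n_algebra n \<omega>\<^esub> H4n_class n \<omega> p = H4n_class n \<omega> (scalar r * p)"
    using rcoset_mult_add[of "scalar r" p]
    by (simp add: H4n_algebra_def ring.defs module.defs FactRing_def H4n_class_def)
qed

lemma H4n_eq_H4n_algebra:
  "carrier (H4n n \<omega>) = carrier (H4n_algebra n \<omega>)"
  "A \<otimes>\<^bsub>H4n n \<omega>\<^esub> B = A \<otimes>\<^bsub>H4n_algebra n \<omega>\<^esub> B"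
  "A \<oplus>\<^bsub>H4n n \<omega>\<^esub> B = A \<oplus>\<^bsub>H4n_algebra n \<omega>\<^esub> B"
  "\<one>\<^bsub>H4n n \<omega>\<^esub> = \<one>\<^bsub>H4n_algebra n \<omega>\<^esub>"
  "r \<odot>\<^bsub>H4n n \<omega>\<^esub> A = r \<odot>\<^bsub>H4n_algebra n \<omega>\<^esub> A"
  by (simp_all add: H4n_def module.defs hopf_algebra.defs)

lemmas H4n_simps = H4n_algebra_simps[folded H4n_eq_H4n_algebra]

lemma tensor_class_H4n_algebra:
  "tensor_class (H4n_algebra n \<omega>) (H4n_algebra n \<omega>) = tensor_class (H4n n \<omega>) (H4n n \<omega>)"
  by (intro ext) (simp add: tensor_class_def tensor_rels_def H4n_eq_H4n_algebra)


section \<open>Comultiplication\<close>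

lemma ftensor_single:
  "ftensor (Poly_Mapping.single u r) (Poly_Mapping.single v s) = Poly_Mapping.single (u, v) (r * s)"
  by (simp add: ftensor_def mult_single)

lemma additive_ftensor_left: "additive (\<lambda>p. ftensor p q)"
  by (simp add: additive_def ftensor_def formal_map_add distrib_right)

lemma additive_ftensor_right: "additive (ftensor p)"
  by (simp add: additive_def ftensor_def formal_map_add distrib_left)

lemmas ftensor_add = additive.add[OF additive_ftensor_left] additive.add[OF additive_ftensor_right]
lemmas ftensor_diff = additive.diff[OF additive_ftensor_left] additive.diff[OF additive_ftensor_right]

lemma ftensor_1 [simp]: "ftensor 1 1 = 1"
  using ftensor_single[of 0 1 0 1] by (simp add: zero_prod_def[symmetric])

lemma ftensor_mult: "ftensor p q * ftensor p' q' = ftensor (p * p') (q * q')"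
proof -
  have comm: "formal_map (\<lambda>v. (0, v)) q * formal_map (\<lambda>u. (u, 0)) p' =
    formal_map (\<lambda>u. (u, 0)) p' * formal_map (\<lambda>v. (0, v)) q"
  proof (induction q rule: poly_mapping_induct)
    case (single v s)
    show ?case
      by (induction p' rule: poly_mapping_induct)
        (simp_all add: mult_single formal_map_add distrib_left distrib_right mult.commute)
  qed (simp add: formal_map_add distrib_left distrib_right)
  have "ftensor p q * ftensor p' q' = formal_map (\<lambda>u. (u, 0)) p *
    (formal_map (\<lambda>v. (0, v)) q * formal_map (\<lambda>u. (u, 0)) p') * formal_map (\<lambda>v. (0, v)) q'"
    by (simp add: ftensor_def mult.assoc)
  also have "\<dots> = ftensor (p * p') (q * q')"
    unfolding comm by (simp add: ftensor_def formal_map_mult mult.assoc)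
  finally show ?thesis .
qed

lemma ftensor_power: "ftensor p q ^ m = ftensor (p ^ m) (q ^ m)"
  by (induction m) (simp_all add: ftensor_mult)

lemma ftensor_scalar [simp]: "ftensor (scalar r) 1 = scalar r" "ftensor 1 (scalar r) = scalar r"
  using ftensor_single[of 0 r 0 1] ftensor_single[of 0 1 0 r]
  by (simp_all add: scalar_def zero_prod_def)

lemma ftensor_scalar_left: "ftensor (scalar r * p) q = scalar r * ftensor p q"
  using ftensor_mult[of "scalar r" 1 p q] by simp

lemma ftensor_scalar_right: "ftensor p (scalar r * q) = scalar r * ftensor p q"
  using ftensor_mult[of 1 "scalar r" p q] by simp

text \<open>
  The comultiplication of the free algebra takes values in the monoid algebra of pairs of words. This
  is the map from there to the formal combinations of pairs of cosets.
\<close>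

definition H4n_proj ::
    "nat \<Rightarrow> 'k::field \<Rightarrow> (gen word \<times> gen word \<Rightarrow>\<^sub>0 'k)
      \<Rightarrow> ((gen, 'k) free_alg set \<times> (gen, 'k) free_alg set \<Rightarrow>\<^sub>0 'k)"
  where "H4n_proj n \<omega> = formal_map (\<lambda>(u, v). (H4n_class n \<omega> (Poly_Mapping.single u 1),
                       H4n_class n \<omega> (Poly_Mapping.single v 1)))"

abbreviation H4n_tensor_cong where
  "H4n_tensor_cong n \<omega> \<equiv> tensor_cong (H4n n \<omega>) (H4n n \<omega>)"

lemma H4n_tensor_class_eq:
  "H4n_tensor_class n \<omega> T = tensor_class (H4n n \<omega>) (H4n n \<omega>) (H4n_proj n \<omega> T)"
  by (simp add: H4n_tensor_class_def H4n_proj_def tensor_class_H4n_algebra)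

lemma H4n_proj_single [simp]:
  "H4n_proj n \<omega> (Poly_Mapping.single (u, v) r) =
    Poly_Mapping.single (H4n_class n \<omega> (Poly_Mapping.single u 1), H4n_class n \<omega> (Poly_Mapping.single v 1)) r"
  by (simp add: H4n_proj_def)

lemma additive_H4n_proj: "additive (H4n_proj n \<omega>)"
  unfolding H4n_proj_def by (rule additive_formal_map)

lemmas H4n_proj_add = additive.add[OF additive_H4n_proj]
lemmas H4n_proj_diff = additive.diff[OF additive_H4n_proj]
lemmas H4n_proj_0 = additive.zero[OF additive_H4n_proj]

lemma H4n_class_carrier [simp]: "H4n_class n \<omega> p \<in> carrier (H4n n \<omega>)"
  by (simp add: H4n_simps)

text \<open>
  Both sides represent \<open>p \<otimes> q\<close>: on the left expanded into words, on the right as one pair of cosets.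
\<close>

lemma H4n_proj_ftensor:
  "H4n_tensor_cong n \<omega> (H4n_proj n \<omega> (ftensor p q))
    (Poly_Mapping.single (H4n_class n \<omega> p, H4n_class n \<omega> q) 1)"
proof (induction p rule: poly_mapping_induct)
  case (single u r)
  show ?case
  proof (induction q rule: poly_mapping_induct)
    case (single v s)
    let ?u = "H4n_class n \<omega> (Poly_Mapping.single u 1)" and ?v = "H4n_class n \<omega> (Poly_Mapping.single v 1)"
    have u: "H4n_class n \<omega> (Poly_Mapping.single u r) = r \<odot>\<^bsub>H4n n \<omega>\<^esub> ?u"
      and v: "H4n_class n \<omega> (Poly_Mapping.single v s) = s \<odot>\<^bsub>H4n n \<omega>\<^esub> ?v"
      by (simp_all add: H4n_simps scalar_def mult_single)
    have "H4n_tensor_cong n \<omega> (Poly_Mapping.single (r \<odot>\<^bsub>H4n n \<omega>\<^esub> ?u, s \<odot>\<^bsub>H4n n \<omega>\<^esub> ?v) 1)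
        (fscale r (Poly_Mapping.single (?u, s \<odot>\<^bsub>H4n n \<omega>\<^esub> ?v) 1))"
      using tensor_cong_smult_left[of ?u "H4n n \<omega>" "s \<odot>\<^bsub>H4n n \<omega>\<^esub> ?v" "H4n n \<omega>" r]
      by (simp flip: v)
    also have "H4n_tensor_cong n \<omega> \<dots> (fscale r (Poly_Mapping.single (?u, ?v) s))"
      by (intro tensor_cong_fscale tensor_cong_smult_right) simp_all
    finally show ?case
      unfolding u v ftensor_single H4n_proj_single fscale_single by (rule tensor_cong_sym)
  next
    case (add q q')
    have "H4n_tensor_cong n \<omega> (H4n_proj n \<omega> (ftensor (Poly_Mapping.single u r) (q + q')))
      (Poly_Mapping.single (H4n_class n \<omega> (Poly_Mapping.single u r), H4n_class n \<omega> q) 1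
        + Poly_Mapping.single (H4n_class n \<omega> (Poly_Mapping.single u r), H4n_class n \<omega> q') 1)"
      unfolding ftensor_add H4n_proj_add by (rule tensor_cong_add[OF add])
    also have "H4n_tensor_cong n \<omega> \<dots>
      (Poly_Mapping.single (H4n_class n \<omega> (Poly_Mapping.single u r), H4n_class n \<omega> (q + q')) 1)"
      unfolding H4n_simps[symmetric] by (rule tensor_cong_sym, rule tensor_cong_add_right) simp_all
    finally show ?case .
  qed
next
  case (add p p')
  have "H4n_tensor_cong n \<omega> (H4n_proj n \<omega> (ftensor (p + p') q))
    (Poly_Mapping.single (H4n_class n \<omega> p, H4n_class n \<omega> q) 1
      + Poly_Mapping.single (H4n_class n \<omega> p', H4n_class n \<omega> q) 1)"
    unfolding ftensor_add H4n_proj_add by (rule tensor_cong_add[OF add])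
  also have "H4n_tensor_cong n \<omega> \<dots>
    (Poly_Mapping.single (H4n_class n \<omega> (p + p'), H4n_class n \<omega> q) 1)"
    unfolding H4n_simps[symmetric] by (rule tensor_cong_sym, rule tensor_cong_add_left) simp_all
  finally show ?case .
qed

lemma H4n_class_ideal: "p \<in> H4n_ideal n \<omega> \<Longrightarrow> H4n_class n \<omega> p = H4n_class n \<omega> 0"
  by (simp add: H4n_class_eq_iff H4n_cong_def)

text \<open>
  The kernel of the projection onto \<open>H\<^sub>\<omega> \<otimes> H\<^sub>\<omega>\<close>. It is a two-sided ideal, so the comultiplication
  factors through \<open>H\<^sub>\<omega>\<close> as soon as it maps the relators into it.
\<close>

definition H4n_tensor_kernel :: "nat \<Rightarrow> 'k::field \<Rightarrow> (gen word \<times> gen word \<Rightarrow>\<^sub>0 'k) set"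
  where "H4n_tensor_kernel n \<omega> = {T. H4n_tensor_cong n \<omega> (H4n_proj n \<omega> T) 0}"

lemma ftensor_in_kernel:
  assumes "p \<in> H4n_ideal n \<omega> \<or> q \<in> H4n_ideal n \<omega>"
  shows "ftensor p q \<in> H4n_tensor_kernel n \<omega>"
proof -
  have "H4n_tensor_cong n \<omega> (H4n_proj n \<omega> (ftensor p q))
    (Poly_Mapping.single (H4n_class n \<omega> p, H4n_class n \<omega> q) 1)"
    by (rule H4n_proj_ftensor)
  also have "H4n_tensor_cong n \<omega> \<dots> 0"
  proof -
    have zero: "H4n_class n \<omega> 0 = 0 \<odot>\<^bsub>H4n n \<omega>\<^esub> H4n_class n \<omega> 0" by (simp add: H4n_simps)
    show ?thesis using assms
    proof
      assume "p \<in> H4n_ideal n \<omega>"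
      from H4n_class_ideal[OF this] show ?thesis
        using tensor_cong_smult_left[of "H4n_class n \<omega> 0" "H4n n \<omega>" "H4n_class n \<omega> q" "H4n n \<omega>" 0]
        by (simp flip: zero)
    next
      assume "q \<in> H4n_ideal n \<omega>"
      from H4n_class_ideal[OF this] show ?thesis
        using tensor_cong_smult_right[of "H4n_class n \<omega> p" "H4n n \<omega>" "H4n_class n \<omega> 0" "H4n n \<omega>" 0]
        by (simp flip: zero)
    qed
  qed
  finally show ?thesis by (simp add: H4n_tensor_kernel_def)
qed

lemma H4n_tensor_kernel_0: "0 \<in> H4n_tensor_kernel n \<omega>"
  by (simp add: H4n_tensor_kernel_def H4n_proj_0)

lemma H4n_tensor_kernel_add:
  "T \<in> H4n_tensor_kernel n \<omega> \<Longrightarrow> T' \<in> H4n_tensor_kernel n \<omega> \<Longrightarrow> T + T' \<in> H4n_tensor_kernel n \<omega>"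
  unfolding H4n_tensor_kernel_def mem_Collect_eq H4n_proj_add
  using tensor_cong_add[of _ _ _ 0 _ 0] by fastforce

lemma scalar_left_commute: "q * (scalar r * p) = scalar r * (q * p)"
  using arg_cong[OF scalar_commute[of r q], of "\<lambda>z. z * p"] by (simp add: mult.assoc)

lemma H4n_tensor_kernel_left:
  assumes "T \<in> H4n_tensor_kernel n \<omega>"
  shows "S * T \<in> H4n_tensor_kernel n \<omega>"
proof (induction S rule: poly_mapping_induct)
  case (single z r)
  obtain u v where z: "z = (u, v)" by (cases z)
  let ?L = "\<lambda>u A. H4n_class n \<omega> (Poly_Mapping.single u 1) \<otimes>\<^bsub>H4n n \<omega>\<^esub> A"
  have L: "carrier_linear (H4n n \<omega>) (H4n n \<omega>) (?L u)" for u
    by (auto simp: carrier_linear_def H4n_simps distrib_left scalar_left_commute)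
  have "H4n_proj n \<omega> (Poly_Mapping.single (u, v) r * S) =
    fscale r (formal_map (map_prod (?L u) (?L v)) (H4n_proj n \<omega> S))" for S
  proof (induction S rule: poly_mapping_induct)
    case (single z' s)
    then show ?case by (cases z') (simp add: mult_single H4n_simps)
  qed (simp add: distrib_left H4n_proj_add formal_map_add formal.scale_right_distrib)
  then show ?case
    using tensor_cong_fscale[OF tensor_cong_formal_map[OF L[of u] L[of v] assms[unfolded H4n_tensor_kernel_def mem_Collect_eq]], of r]
    by (simp add: H4n_tensor_kernel_def z additive.zero[OF additive_formal_map])
qed (simp add: distrib_right H4n_tensor_kernel_add)

lemma H4n_tensor_kernel_right:
  assumes "T \<in> H4n_tensor_kernel n \<omega>"
  shows "T * S \<in> H4n_tensor_kernel n \<omega>"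
proof (induction S rule: poly_mapping_induct)
  case (single z r)
  obtain u v where z: "z = (u, v)" by (cases z)
  let ?R = "\<lambda>u A. A \<otimes>\<^bsub>H4n n \<omega>\<^esub> H4n_class n \<omega> (Poly_Mapping.single u 1)"
  have R: "carrier_linear (H4n n \<omega>) (H4n n \<omega>) (?R u)" for u
    by (auto simp: carrier_linear_def H4n_simps distrib_right mult.assoc)
  have "H4n_proj n \<omega> (S * Poly_Mapping.single (u, v) r) =
    fscale r (formal_map (map_prod (?R u) (?R v)) (H4n_proj n \<omega> S))" for S
  proof (induction S rule: poly_mapping_induct)
    case (single z' s)
    then show ?case by (cases z') (simp add: mult_single H4n_simps mult.commute)
  qed (simp add: distrib_right H4n_proj_add formal_map_add formal.scale_right_distrib)
  then show ?case
    using tensor_cong_fscale[OF tensor_cong_formal_map[OF R[of u] R[of v] assms[unfolded H4n_tensor_kernel_def mem_Collect_eq]], of r]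
    by (simp add: H4n_tensor_kernel_def z additive.zero[OF additive_formal_map])
qed (simp add: distrib_left H4n_tensor_kernel_add)

abbreviation free_comult :: "(gen, 'k::field) free_alg \<Rightarrow> (gen word \<times> gen word \<Rightarrow>\<^sub>0 'k)"
  where "free_comult \<equiv> free_lift scalar comult_gen"

lemmas free_lift_add = additive.add[OF additive_free_lift]
lemmas free_lift_diff = additive.diff[OF additive_free_lift]
lemmas free_lift_minus = additive.minus[OF additive_free_lift]
lemmas free_lift_0 = additive.zero[OF additive_free_lift]

lemmas free_lift_scalar_simps [simp] =
  free_lift_add[OF central_unit_map_scalar] free_lift_diff[OF central_unit_map_scalar]
  free_lift_minus[OF central_unit_map_scalar] free_lift_0[OF central_unit_map_scalar]
  free_lift_mult[OF central_unit_map_scalar] free_lift_power[OF central_unit_map_scalar]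
  free_lift_generator[OF central_unit_map_scalar] free_lift_scalar[OF central_unit_map_scalar]
  free_lift_one[OF central_unit_map_scalar]

lemma H4n_ideal_relations:
  "fg ^ 2 - 1 \<in> H4n_ideal n \<omega>" "fc ^ n - 1 \<in> H4n_ideal n \<omega>" "fx ^ 2 \<in> H4n_ideal n \<omega>"
  "fx * fg + fg * fx \<in> H4n_ideal n \<omega>" "fc * fg - fg * fc \<in> H4n_ideal n \<omega>"
  "fc * fx - scalar \<omega> * (fx * fc) \<in> H4n_ideal n \<omega>"
  by (rule H4n_relator_in_ideal, simp add: H4n_relators_def)+

text \<open>
  The comultiplication of each relator is a sum of tensors that have a relator as one of their
  factors.
\<close>

lemma free_comult_ideal:
  assumes "p \<in> H4n_ideal n \<omega>"
  shows "free_comult p \<in> H4n_tensor_kernel n \<omega>"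
proof -
  let ?J = "{p. free_comult p \<in> H4n_tensor_kernel n \<omega>}"
  have "H4n_ideal n \<omega> \<subseteq> ?J"
  proof (rule H4n_ideal_minimal)
    show "ideal ?J free_algebra"
      by (rule ideal_free_algebraI)
        (simp_all add: H4n_tensor_kernel_0 H4n_tensor_kernel_add H4n_tensor_kernel_left H4n_tensor_kernel_right)
    have 1: "free_comult (fg ^ 2 - 1) =
      ftensor (fg ^ 2 - 1) (fg ^ 2) + ftensor 1 (fg ^ 2 - 1)"
      by (simp add: ftensor_power ftensor_diff)
    have 2: "free_comult (fc ^ n - 1) =
      ftensor (fc ^ n - 1) (fc ^ n) + ftensor 1 (fc ^ n - 1)"
      by (simp add: ftensor_power ftensor_diff)
    have 3: "free_comult (fx ^ 2) =
      ftensor (fx ^ 2) 1 + (ftensor (fx * fg + fg * fx) fx + ftensor (fg ^ 2) (fx ^ 2))"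
      by (simp add: power2_eq_square ftensor_mult ftensor_add distrib_left distrib_right)
    have 4: "free_comult (fx * fg - (- (fg * fx))) =
      ftensor (fx * fg + fg * fx) fg + ftensor (fg ^ 2) (fx * fg + fg * fx)"
      by (simp add: power2_eq_square ftensor_mult ftensor_add distrib_left distrib_right)
    have 5: "free_comult (fc * fg - fg * fc) =
      ftensor (fc * fg - fg * fc) (fc * fg) + ftensor (fg * fc) (fc * fg - fg * fc)"
      by (simp add: ftensor_mult ftensor_diff)
    have 6: "free_comult (fc * fx - scalar \<omega> * (fx * fc)) =
      ftensor (fc * fx - scalar \<omega> * (fx * fc)) fc +
      (ftensor (fc * fg - fg * fc) (fc * fx) + ftensor (fg * fc) (fc * fx - scalar \<omega> * (fx * fc)))"
      by (simp add: ftensor_mult ftensor_diff distrib_left distrib_right ftensor_scalar_left ftensor_scalar_right)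
    show "H4n_relators n \<omega> \<subseteq> ?J"
      unfolding H4n_relators_def insert_subset mem_Collect_eq 1 2 3 4 5 6
      by (intro conjI empty_subsetI H4n_tensor_kernel_add)
        (rule ftensor_in_kernel, (rule disjI1, rule H4n_ideal_relations | rule disjI2, rule H4n_ideal_relations))+
  qed
  then show ?thesis using assms by blast
qed

lemma the_elem_image_H4n_class:
  assumes "\<And>q. H4n_cong n \<omega> q p \<Longrightarrow> F q = F p"
  shows "the_elem (F ` H4n_class n \<omega> p) = F p"
  by (rule the_elem_image_const, simp add: H4n_class_eq) (rule assms, simp add: H4n_class_eq)

lemma comult_H4n:
  "comult (H4n n \<omega>) (H4n_class n \<omega> p) = tensor_class (H4n n \<omega>) (H4n n \<omega>) (H4n_proj n \<omega> (free_comult p))"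
proof -
  have "comult (H4n n \<omega>) (H4n_class n \<omega> p) =
    the_elem ((\<lambda>p. H4n_tensor_class n \<omega> (free_comult p)) ` H4n_class n \<omega> p)"
    by (simp add: H4n_def module.defs hopf_algebra.defs)
  also have "\<dots> = H4n_tensor_class n \<omega> (free_comult p)"
  proof (rule the_elem_image_H4n_class)
    fix q assume "H4n_cong n \<omega> q p"
    from free_comult_ideal[OF this[unfolded H4n_cong_def]]
    show "H4n_tensor_class n \<omega> (free_comult q) = H4n_tensor_class n \<omega> (free_comult p)"
      by (simp add: H4n_tensor_class_eq tensor_class_eq_iff H4n_tensor_kernel_def H4n_proj_diff tensor_cong_def)
  qed
  finally show ?thesis by (simp add: H4n_tensor_class_eq)
qed

section \<open>Counit and antipode\<close>

abbreviation free_counit :: "(gen, 'k::field) free_alg \<Rightarrow> 'k"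
  where "free_counit \<equiv> free_lift (\<lambda>r. r) counit_gen"

lemmas free_counit_simps [simp] =
  free_lift_add[OF central_unit_map_id] free_lift_diff[OF central_unit_map_id]
  free_lift_minus[OF central_unit_map_id] free_lift_0[OF central_unit_map_id]
  free_lift_mult[OF central_unit_map_id] free_lift_power[OF central_unit_map_id]
  free_lift_generator[OF central_unit_map_id] free_lift_scalar[OF central_unit_map_id]
  free_lift_one[OF central_unit_map_id]

lemma counit_H4n: "counit (H4n n \<omega>) (H4n_class n \<omega> p) = free_counit p"
proof -
  let ?J = "{p :: (gen, 'a) free_alg. free_counit p = 0}"
  have "H4n_ideal n \<omega> \<subseteq> ?J"
    by (rule H4n_ideal_minimal, rule ideal_free_algebraI) (simp_all add: H4n_relators_def)
  then have const: "free_counit q = free_counit p" if "H4n_cong n \<omega> q p" for q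
    using that by (auto simp: H4n_cong_def)
  have "counit (H4n n \<omega>) (H4n_class n \<omega> p) = the_elem (free_counit ` H4n_class n \<omega> p)"
    by (simp add: H4n_def module.defs hopf_algebra.defs)
  also have "\<dots> = free_counit p" by (rule the_elem_image_H4n_class) (rule const)
  finally show ?thesis .
qed

abbreviation free_antipode :: "nat \<Rightarrow> (gen, 'k::field) free_alg \<Rightarrow> (gen, 'k) free_alg"
  where "free_antipode n \<equiv> free_antilift scalar (antipode_gen n)"

lemmas free_antilift_simps [simp] =
  additive.add[OF additive_free_antilift] additive.diff[OF additive_free_antilift]
  additive.minus[OF additive_free_antilift] additive.zero[OF additive_free_antilift]
  free_antilift_mult free_antilift_power

text \<open>
  The hypotheses on \<open>n\<close> and \<open>\<omega>\<close> enter through the inverse of \<open>c\<close>, which is represented by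
  \<open>c\<^sup>n\<^sup>-\<^sup>1\<close> and commutes with \<open>x\<close> up to the factor \<open>\<omega>\<^sup>n\<^sup>-\<^sup>1 = \<omega>\<^sup>-\<^sup>1\<close>.
\<close>

lemma free_antipode_ideal:
  assumes \<omega>: "\<omega> ^ n = 1" and n: "n > 0" and p: "p \<in> H4n_ideal n \<omega>"
  shows "free_antipode n p \<in> H4n_ideal n \<omega>"
proof -
  let ?J = "{p. free_antipode n p \<in> H4n_ideal n \<omega>}"
  have "H4n_ideal n \<omega> \<subseteq> ?J"
  proof (rule H4n_ideal_minimal)
    show "ideal ?J free_algebra"
      by (rule ideal_free_algebraI)
        (simp_all add: H4n_ideal_add H4n_ideal_left H4n_ideal_right)
    have "coord n \<omega> j i (k - int (n - 1) * int n) 1 = coord n \<omega> j i k 1" for j i k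
      by (rule coord_cong) simp_all
    moreover have "\<omega> ^ (j * ((n - 1) * n)) = 1" for j
      using power_mult[of \<omega> n "j * (n - 1)"] \<omega> by (simp add: ac_simps)
    ultimately have c: "free_antipode n (fc ^ n - 1) \<in> H4n_ideal n \<omega>"
      by (simp add: coord_eq_0_iff[OF \<omega> n] coord_diff coord_c_power flip: power_mult)
    have "\<omega> ^ (n - 1) * \<omega> = 1" using power_minus_mult[OF n, of \<omega>] \<omega> by simp
    then have cx: "free_antipode n (fc * fx - scalar \<omega> * (fx * fc)) \<in> H4n_ideal n \<omega>"
      by (simp add: coord_eq_0_iff[OF \<omega> n] mult.assoc coord_diff coord_minus coord_mult_simps
          coord_c_power coord_x coord_scalar coord_1)
    show "H4n_relators n \<omega> \<subseteq> ?J"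
      unfolding H4n_relators_def insert_subset mem_Collect_eq
      by (intro conjI empty_subsetI c cx; simp only: coord_eq_0_iff[OF \<omega> n];
          simp add: power2_eq_square mult.assoc coord_diff coord_add coord_minus coord_scalar_mult
            coord_mult_simps coord_1 coord_g coord_x coord_c_power)
  qed
  then show ?thesis using p by blast
qed

lemma antipode_H4n:
  assumes \<omega>: "\<omega> ^ n = 1" and n: "n > 0"
  shows "antipode (H4n n \<omega>) (H4n_class n \<omega> p) = H4n_class n \<omega> (free_antipode n p)"
proof -
  have const: "H4n_class n \<omega> (free_antipode n q) = H4n_class n \<omega> (free_antipode n p)"
    if "H4n_cong n \<omega> q p" for q
    using that free_antipode_ideal[OF \<omega> n, of "q - p"] by (simp add: H4n_class_eq_iff H4n_cong_def)
  have "antipode (H4n n \<omega>) (H4n_class n \<omega> p) =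
    the_elem ((\<lambda>p. H4n_class n \<omega> (free_antipode n p)) ` H4n_class n \<omega> p)"
    by (simp add: H4n_def module.defs hopf_algebra.defs)
  also have "\<dots> = H4n_class n \<omega> (free_antipode n p)"
    by (rule the_elem_image_H4n_class) (rule const)
  finally show ?thesis .
qed


section \<open>The comultiplication in coordinates\<close>

lemma coord_ge_2:
  assumes "j \<ge> 2"
  shows "coord n \<omega> j i k p = 0"
proof -
  have "mono_coeff \<omega> j w = 0" for w 
  proof (induction w)
    case (Cons a w)
    then show ?case using assms by (cases a) auto
  qed (use assms in simp)
  then have "word_coord n \<omega> j i k w = 0" for w by (simp add: word_coord_def)
  then show ?thesis by (simp add: coord_def)
qed

lemma tensor_eval_single_mult:
  "tensor_eval \<phi> \<psi> (Poly_Mapping.single (u, v) r * T) =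
    r * tensor_eval (\<lambda>w. \<phi> (u + w)) (\<lambda>w. \<psi> (v + w)) T"
proof (induction T rule: poly_mapping_induct)
  case (single z s)
  then show ?case by (cases z) (simp add: mult_single)
qed (simp add: distrib_left tensor_eval_add)

lemma tensor_eval_scale:
  "tensor_eval (\<lambda>w. a * \<phi> w) (\<lambda>w. b * \<psi> w) T = a * b * tensor_eval \<phi> \<psi> T"
proof (induction T rule: poly_mapping_induct)
  case (single z s)
  then show ?case by (cases z) simp
qed (simp add: distrib_left tensor_eval_add)

lemma word_coord_Cons:
  "word_coord n \<omega> j i k (Word [Gen_g] + w) = (- 1) ^ j * word_coord n \<omega> j (i - 1) k w"
  "word_coord n \<omega> j i k (Word [Gen_c] + w) = \<omega> ^ j * word_coord n \<omega> j i (k - 1) w"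
  "word_coord n \<omega> j i k (Word [Gen_x] + w) = (if j = 1 then 1 else 0) * word_coord n \<omega> 0 i k w"
  using coord_g_mult[of n \<omega> j i k "Poly_Mapping.single w 1"]
    coord_c_mult[of n \<omega> j i k "Poly_Mapping.single w 1"]
    coord_x_mult[of n \<omega> j i k "Poly_Mapping.single w 1"]
  by (simp_all add: generator_def mult_single coord_single)

text \<open>
  The coefficient of \<open>x\<^sup>j g\<^sup>i c\<^sup>k \<otimes> x\<^sup>j\<^sup>' g\<^sup>i\<^sup>' c\<^sup>k\<^sup>'\<close> in \<open>\<Delta>(p)\<close>. It reflects that \<open>g\<^sup>i c\<^sup>k\<close> is group-like and
  that \<open>\<Delta>(x g\<^sup>i c\<^sup>k) = x g\<^sup>i c\<^sup>k \<otimes> g\<^sup>i c\<^sup>k + g\<^sup>i\<^sup>+\<^sup>1 c\<^sup>k \<otimes> x g\<^sup>i c\<^sup>k\<close>; the factor \<open>g\<close> in the second term accounts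
  for the shift of \<open>i\<close> by \<open>j'\<close>. For \<open>j = j' = 1\<close> the two contributions of a letter \<open>x\<close> cancel.
\<close>

lemma coord_comult:
  "tensor_eval (word_coord n \<omega> j i k) (word_coord n \<omega> j' i' k') (free_comult p) =
    (if even (i - i' - int j') \<and> int n dvd k - k' then coord n \<omega> (j + j') i' k' p else 0)"
proof (induction p arbitrary: j i k j' i' k' rule: free_alg_induct)
  case (scalar r)
  have "int n dvd k \<longleftrightarrow> int n dvd k - k'" if "int n dvd k'"
    using that by (simp add: dvd_diff_left_iff)
  moreover have "scalar r = Poly_Mapping.single (0 :: gen word, 0 :: gen word) r"
    by (simp add: scalar_def zero_prod_def)
  ultimately show ?case
    by (auto simp: coord_scalar word_coord_def zero_word_def)
next
  case (generator a p)
  have left: "tensor_eval \<phi> \<psi> (ftensor (generator b) (generator b') * T) =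
      tensor_eval (\<lambda>w. \<phi> (Word [b] + w)) (\<lambda>w. \<psi> (Word [b'] + w)) T"
    "tensor_eval \<phi> \<psi> (ftensor (generator b) 1 * T) = tensor_eval (\<lambda>w. \<phi> (Word [b] + w)) \<psi> T"
    for \<phi> \<psi> :: "gen word \<Rightarrow> 'a" and b b' T
    using tensor_eval_single_mult[of \<phi> \<psi> "Word [b]" "Word [b']" 1 T]
      tensor_eval_single_mult[of \<phi> \<psi> "Word [b]" 0 1 T]
      ftensor_single[of "Word [b]" "1::'a" "Word [b']" 1] ftensor_single[of "Word [b]" "1::'a" 0 1]
    by (simp_all add: generator_def)
  note eval = left word_coord_Cons tensor_eval_scale
    tensor_eval_scale[where a = 1, simplified mult_1_left] tensor_eval_scale[where b = 1, simplified mult_1_left]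
  show ?case
  proof (cases a)
    case Gen_g
    then show ?thesis by (simp add: eval generator coord_g_mult power_add)
  next
    case Gen_c
    then show ?thesis by (simp add: eval generator coord_c_mult power_add)
  next
    case Gen_x
    have "even (i - 1 - i') \<longleftrightarrow> odd (i - i')" by presburger
    moreover consider "j = 0" "j' = 0" | "j = 0" "j' = 1" | "j = 1" "j' = 0" | "j = 1" "j' = 1"
      | "j \<ge> 2" | "j' \<ge> 2" by linarith
    ultimately show ?thesis
      using Gen_x
      by cases (auto simp: distrib_right tensor_eval_add eval generator coord_x_mult coord_ge_2)
  qed
next
  case (add p q)
  then show ?case by (simp add: tensor_eval_add coord_add)
qed

definition class_coord :: "nat \<Rightarrow> 'k::field \<Rightarrow> nat \<Rightarrow> int \<Rightarrow> int \<Rightarrow> (gen, 'k) free_alg set \<Rightarrow> 'k"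
  where "class_coord n \<omega> j i k A = the_elem (coord n \<omega> j i k ` A)"

lemma class_coord_class:
  assumes "\<omega> ^ n = 1"
  shows "class_coord n \<omega> j i k (H4n_class n \<omega> p) = coord n \<omega> j i k p"
  unfolding class_coord_def
proof (rule the_elem_image_H4n_class)
  fix q assume "H4n_cong n \<omega> q p"
  then show "coord n \<omega> j i k q = coord n \<omega> j i k p"
    using coord_ideal[OF assms, of "q - p" j i k] by (simp add: H4n_cong_def coord_diff)
qed

lemma carrier_functional_class_coord:
  assumes "\<omega> ^ n = 1"
  shows "carrier_functional (H4n n \<omega>) (class_coord n \<omega> j i k)"
  unfolding carrier_functional_def H4n_simps
  by (auto simp: H4n_simps class_coord_class[OF assms] coord_add coord_scalar_mult)

lemma tensor_eval_H4n_proj: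
  assumes "\<omega> ^ n = 1"
  shows "tensor_eval (class_coord n \<omega> j i k) (class_coord n \<omega> j' i' k') (H4n_proj n \<omega> T) =
    tensor_eval (word_coord n \<omega> j i k) (word_coord n \<omega> j' i' k') T"
proof (induction T rule: poly_mapping_induct)
  case (single z r)
  then show ?case by (cases z) (simp add: class_coord_class[OF assms] coord_single)
qed (simp add: H4n_proj_add tensor_eval_add)

lemma H4n_cong_iff_coord:
  assumes "\<omega> ^ n = 1" "n > 0"
  shows "H4n_cong n \<omega> p q \<longleftrightarrow> (\<forall>j i k. coord n \<omega> j i k p = coord n \<omega> j i k q)"
  by (simp add: H4n_cong_def coord_eq_0_iff[OF assms] coord_diff)

text \<open>
  The coefficients at \<open>x g\<^sup>i c\<^sup>k \<otimes> x g\<^sup>i c\<^sup>k\<close> show that the squares of the coordinates with \<open>j = 1\<close> vanish.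
  The coordinates \<open>a\<^sub>u\<close> with \<open>j = 0\<close>, indexed by the group elements \<open>u = g\<^sup>i c\<^sup>k\<close>, satisfy
  \<open>a\<^sub>u a\<^sub>v = 0\<close> for \<open>u \<noteq> v\<close> and \<open>a\<^sub>u\<^sup>2 = a\<^sub>u\<close>, so exactly one of them is \<open>1\<close> and the others are \<open>0\<close>.
\<close>

lemma grouplike_cong:
  assumes \<omega>: "\<omega> ^ n = 1" and n: "n > 0" and p: "p \<notin> H4n_ideal n \<omega>"
    and grp: "\<And>j i k j' i' k'. tensor_eval (word_coord n \<omega> j i k) (word_coord n \<omega> j' i' k') (free_comult p) =
      coord n \<omega> j i k p * coord n \<omega> j' i' k' p"
  shows "\<exists>i<2. \<exists>k<n. H4n_cong n \<omega> p (fg ^ i * fc ^ k)"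
proof -
  have grp: "coord n \<omega> j i k p * coord n \<omega> j' i' k' p =
      (if even (i - i' - int j') \<and> int n dvd k - k' then coord n \<omega> (j + j') i' k' p else 0)"
    for j i k j' i' k'
    using grp[of j i k j' i' k'] by (simp only: coord_comult)
  have "coord n \<omega> 1 i k p * coord n \<omega> 1 i k p = 0" for i k
    unfolding grp[of 1 i k 1 i k] by simp
  then have "coord n \<omega> 1 i k p = 0" for i k by simp
  then have c1: "coord n \<omega> j i k p = 0" if "j \<noteq> 0" for j i k
    using that coord_ge_2[of j] by (cases "j = 1") simp_all
  obtain j i0 k0 where "coord n \<omega> j i0 k0 p \<noteq> 0"
    using p by (auto simp: coord_eq_0_iff[OF \<omega> n])
  with c1[of j i0 k0] have nz: "coord n \<omega> 0 i0 k0 p \<noteq> 0"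
    by (cases "j = 0") simp_all
  \<comment> \<open>a nonzero idempotent of the field\<close>
  have one: "coord n \<omega> 0 i0 k0 p = 1"
    using grp[of 0 i0 k0 0 i0 k0] nz by simp
  have c0: "coord n \<omega> 0 i k p = (if even (i - i0) \<and> int n dvd k - k0 then 1 else 0)" for i k
  proof (cases "even (i - i0) \<and> int n dvd k - k0")
    case True
    then show ?thesis using coord_cong[of i i0 n k k0 \<omega> 0 p] one by simp
  next
    case False
    then have *: "\<not> (even (i0 - i) \<and> int n dvd k0 - k)"
      by (simp only: dvd_diff_commute[of "2::int" i0 i] dvd_diff_commute[of "int n" k0 k] simp_thms)
    have "coord n \<omega> 0 i k p = coord n \<omega> 0 i0 k0 p * coord n \<omega> 0 i k p" by (simp add: one)
    also have "\<dots> = 0" using * by (subst grp) auto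
    finally show ?thesis using False by simp
  qed
  let ?i = "nat (i0 mod 2)" and ?k = "nat (k0 mod int n)"
  have i: "even (i - int ?i) \<longleftrightarrow> even (i - i0)" for i
    by simp
  have k: "int n dvd k - int ?k \<longleftrightarrow> int n dvd k - k0" for k
    using n mod_eq_dvd_iff[of k "int n" "k0 mod int n"] mod_eq_dvd_iff[of k "int n" k0] by simp
  have "coord n \<omega> j i k p = coord n \<omega> j i k (basis_mono 0 ?i ?k)" for j i k
    by (cases "j = 0") (simp_all only: coord_basis_mono[OF pos2] i k c0 c1 simp_thms if_False)
  then have "H4n_cong n \<omega> p (fg ^ ?i * fc ^ ?k)"
    by (simp add: H4n_cong_iff_coord[OF \<omega> n] basis_mono_def)
  moreover have "?i < 2" "?k < n" using n by (simp_all add: nat_less_iff)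
  ultimately show ?thesis by blast
qed

text \<open>
  Let \<open>b\<^sub>u\<close> and \<open>a\<^sub>u\<close> be the coefficients of \<open>x u\<close> and \<open>u\<close> in \<open>p\<close>, for group elements \<open>u\<close>, and let
  \<open>h\<close> be the group element in the hypothesis. The coefficients at \<open>x u \<otimes> u\<close> leave only \<open>b\<^sub>1\<close>. Those at
  \<open>u \<otimes> u\<close> leave only \<open>a\<^sub>1\<close> and \<open>a\<^sub>h\<close>, whose sum vanishes by the coefficient at \<open>h \<otimes> 1\<close> if \<open>h \<noteq> 1\<close>; if
  \<open>h = 1\<close>, they give \<open>2 a\<^sub>1 = a\<^sub>1\<close>. Finally \<open>b\<^sub>1\<close> occurs at \<open>g \<otimes> x\<close> on the left-hand side, and on the
  right-hand side only if \<open>h = g\<close>.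
\<close>

lemma skew_primitive_cong:
  fixes i\<^sub>0 k\<^sub>0 :: nat
  assumes \<omega>: "\<omega> ^ n = 1" and n: "n > 0"
    and skew: "\<And>j i k j' i' k'. tensor_eval (word_coord n \<omega> j i k) (word_coord n \<omega> j' i' k') (free_comult p) =
      coord n \<omega> j i k p * coord n \<omega> j' i' k' 1 +
      coord n \<omega> j i k (fg ^ i\<^sub>0 * fc ^ k\<^sub>0) * coord n \<omega> j' i' k' p"
  obtains a b where "H4n_cong n \<omega> p (scalar b * fx + scalar a * (1 - fg ^ i\<^sub>0 * fc ^ k\<^sub>0))"
    "b \<noteq> 0 \<Longrightarrow> H4n_cong n \<omega> (fg ^ i\<^sub>0 * fc ^ k\<^sub>0) fg"
proof -
  have h: "coord n \<omega> j i k (fg ^ i\<^sub>0 * fc ^ k\<^sub>0) =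
    (if j = 0 \<and> even (i - int i\<^sub>0) \<and> int n dvd k - int k\<^sub>0 then 1 else 0)" for j i k
    using coord_basis_mono[of 0 n \<omega> j i k i\<^sub>0 k\<^sub>0] by (simp add: basis_mono_def)
  have skew: "coord n \<omega> j i k p * (if j' = 0 \<and> even i' \<and> int n dvd k' then 1 else 0) +
      (if j = 0 \<and> even (i - int i\<^sub>0) \<and> int n dvd k - int k\<^sub>0 then 1 else 0) * coord n \<omega> j' i' k' p =
      (if even (i - i' - int j') \<and> int n dvd k - k' then coord n \<omega> (j + j') i' k' p else 0)"
    for j i k j' i' k'
    using skew[of j i k j' i' k'] by (simp only: coord_comult h coord_1)
  define a b where "a = coord n \<omega> 0 0 0 p" and "b = coord n \<omega> 1 0 0 p"
  have c1: "coord n \<omega> 1 i k p = (if even i \<and> int n dvd k then b else 0)" for i k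
    using skew[of 1 i k 0 i k] coord_cong[of i 0 n k 0 \<omega> 1 p] by (auto simp: b_def)
  have diag: "coord n \<omega> 0 i k p = coord n \<omega> 0 i k p * (if even i \<and> int n dvd k then 1 else 0)
     + (if even (i - int i\<^sub>0) \<and> int n dvd k - int k\<^sub>0 then 1 else 0) * coord n \<omega> 0 i k p" for i k
    using skew[of 0 i k 0 i k] by simp
  have c0: "coord n \<omega> 0 i k p = a * ((if even i \<and> int n dvd k then 1 else 0)
     - (if even (i - int i\<^sub>0) \<and> int n dvd k - int k\<^sub>0 then 1 else 0))" for i k
  proof (cases "even (i - int i\<^sub>0) \<and> int n dvd k - int k\<^sub>0")
    case True
    show ?thesis
    proof (cases "even i \<and> int n dvd k")
      case True2: True
      then show ?thesis using diag[of i k] True by simp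
    next
      case False
      \<comment> \<open>the coefficient at \<open>h \<otimes> 1\<close> with \<open>h \<noteq> 1\<close>\<close>
      then show ?thesis using skew[of 0 i k 0 0 0] True
        by (auto simp: a_def eq_neg_iff_add_eq_0)
    qed
  next
    case False
    then show ?thesis
      using diag[of i k] coord_cong[of i 0 n k 0 \<omega> 0 p] by (auto simp: a_def)
  qed
  have "coord n \<omega> j i k p = coord n \<omega> j i k (scalar b * fx + scalar a * (1 - fg ^ i\<^sub>0 * fc ^ k\<^sub>0))" for j i k
  proof -
    consider "j = 0" | "j = 1" | "j \<ge> 2" by linarith
    then show ?thesis
      by cases (simp_all add: coord_add coord_diff coord_scalar_mult coord_x coord_1 h c0 c1[unfolded One_nat_def] coord_ge_2)
  qed
  then have "H4n_cong n \<omega> p (scalar b * fx + scalar a * (1 - fg ^ i\<^sub>0 * fc ^ k\<^sub>0))"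
    by (simp add: H4n_cong_iff_coord[OF \<omega> n])
  moreover have "H4n_cong n \<omega> (fg ^ i\<^sub>0 * fc ^ k\<^sub>0) fg" if "b \<noteq> 0"
  proof -
    have "odd i\<^sub>0" "int n dvd int k\<^sub>0"
      \<comment> \<open>the coefficient at \<open>g \<otimes> x\<close>\<close>
      using skew[of 0 1 0 1 0 0] that by (auto simp: b_def split: if_splits)
    then have eq: "even (i - int i\<^sub>0) \<longleftrightarrow> even (i - 1)" "int n dvd k - int k\<^sub>0 \<longleftrightarrow> int n dvd k" for i k
      by (simp, simp add: dvd_diff_left_iff)
    have "coord n \<omega> j i k (fg ^ i\<^sub>0 * fc ^ k\<^sub>0) = coord n \<omega> j i k fg" for j i k
      unfolding h coord_g coord_1 eq by simp
    then show ?thesis by (simp add: H4n_cong_iff_coord[OF \<omega> n])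
  qed
  ultimately show ?thesis using that by blast
qed


section \<open>Isomorphisms determine the parameters\<close>

lemma tensor_eval_formal_map:
  "tensor_eval \<phi> \<psi> (formal_map (map_prod f h) T) = tensor_eval (\<lambda>a. \<phi> (f a)) (\<lambda>b. \<psi> (h b)) T"
proof (induction T rule: poly_mapping_induct)
  case (single z r)
  then show ?case by (cases z) simp
qed (simp add: formal_map_add tensor_eval_add)

lemma coord_gc_power_mult:
  "coord n \<omega> j i k ((fg ^ e * fc ^ s) ^ m * p) =
    ((- 1) ^ e * \<omega> ^ s) ^ (j * m) * coord n \<omega> j (i - int (e * m)) (k - int (s * m)) p"
proof (induction m arbitrary: i k)
  case (Suc m)
  have "coord n \<omega> j i k ((fg ^ e * fc ^ s) ^ Suc m * p) =
    ((- 1) ^ e * \<omega> ^ s) ^ j * coord n \<omega> j (i - int e) (k - int s) ((fg ^ e * fc ^ s) ^ m * p)"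
    by (simp add: mult.assoc coord_g_power_mult coord_c_power_mult power_mult_distrib
        flip: power_mult) (simp add: mult.commute)
  then show ?case by (simp add: Suc power_add algebra_simps)
qed simp

lemma coord_gc_power:
  "coord n \<omega> j i k ((fg ^ e * fc ^ s) ^ m) =
    (if j = 0 \<and> even (i - int (e * m)) \<and> int n dvd k - int (s * m) then 1 else 0)"
  using coord_gc_power_mult[of n \<omega> j i k e s m 1] unfolding mult_1_right coord_1 by simp

locale H4n_hopf_mono =
  fixes n :: nat and \<omega> \<omega>' :: "'k::field" and f
  assumes n: "n > 0" and \<omega>: "\<omega> ^ n = 1" and \<omega>': "\<omega>' ^ n = 1"
    and hom: "f \<in> hopf_hom (H4n n \<omega>') (H4n n \<omega>)"
    and inj: "inj_on f (carrier (H4n n \<omega>'))"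
begin

definition represents :: "(gen, 'k) free_alg \<Rightarrow> (gen, 'k) free_alg \<Rightarrow> bool"
  where "represents p q \<longleftrightarrow> f (H4n_class n \<omega>' p) = H4n_class n \<omega> q"

lemma ring_hom: "f \<in> ring_hom (H4n n \<omega>') (H4n n \<omega>)"
  and smult: "a \<in> carrier (H4n n \<omega>') \<Longrightarrow> f (r \<odot>\<^bsub>H4n n \<omega>'\<^esub> a) = r \<odot>\<^bsub>H4n n \<omega>\<^esub> f a"
  and comult_hom: "a \<in> carrier (H4n n \<omega>') \<Longrightarrow>
    comult (H4n n \<omega>) (f a) = tensor_map (H4n n \<omega>) (H4n n \<omega>) f f (comult (H4n n \<omega>') a)"
  using hom by (auto simp: hopf_hom_def)

lemma represents_exists: obtains q where "represents p q"
proof -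
  have "f (H4n_class n \<omega>' p) \<in> carrier (H4n n \<omega>)"
    by (rule ring_hom_closed[OF ring_hom]) simp
  then show ?thesis using that by (auto simp: represents_def H4n_simps)
qed

lemma represents_add: "represents p q \<Longrightarrow> represents p' q' \<Longrightarrow> represents (p + p') (q + q')"
  using ring_hom_add[OF ring_hom, of "H4n_class n \<omega>' p" "H4n_class n \<omega>' p'"]
  by (simp add: represents_def H4n_simps)

lemma represents_mult: "represents p q \<Longrightarrow> represents p' q' \<Longrightarrow> represents (p * p') (q * q')"
  using ring_hom_mult[OF ring_hom, of "H4n_class n \<omega>' p" "H4n_class n \<omega>' p'"]
  by (simp add: represents_def H4n_simps)

lemma represents_scalar: "represents p q \<Longrightarrow> represents (scalar r * p) (scalar r * q)"
  using smult[of "H4n_class n \<omega>' p" r] by (simp add: represents_def H4n_simps)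

lemma represents_diff: "represents p q \<Longrightarrow> represents p' q' \<Longrightarrow> represents (p - p') (q - q')"
  using represents_add[OF _ represents_scalar[of p' q' "- 1"]]
  by (simp add: additive.minus[OF additive_scalar])

lemma represents_1: "represents 1 1"
  using ring_hom_one[OF ring_hom] by (simp add: represents_def H4n_simps)

lemma represents_power: "represents p q \<Longrightarrow> represents (p ^ m) (q ^ m)"
  by (induction m) (simp_all add: represents_1 represents_mult)

lemma represents_cong: "represents p q \<Longrightarrow> H4n_cong n \<omega> q q' \<Longrightarrow> represents p q'"
  by (simp add: represents_def flip: H4n_class_eq_iff)

lemma represents_cong_iff:
  assumes "represents p q" "represents p' q'"
  shows "H4n_cong n \<omega>' p p' \<longleftrightarrow> H4n_cong n \<omega> q q'"
  using assms inj_on_eq_iff[OF inj, of "H4n_class n \<omega>' p" "H4n_class n \<omega>' p'"]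
  by (simp add: represents_def flip: H4n_class_eq_iff)

lemma carrier_linear: "carrier_linear (H4n n \<omega>') (H4n n \<omega>) f"
  using ring_hom_closed[OF ring_hom] ring_hom_add[OF ring_hom] smult
  by (auto simp: carrier_linear_def)

lemma represents_comult:
  assumes "represents p q"
  shows "tensor_eval (word_coord n \<omega> j i k) (word_coord n \<omega> j' i' k') (free_comult q) =
    tensor_eval (\<lambda>A. class_coord n \<omega> j i k (f A)) (\<lambda>A. class_coord n \<omega> j' i' k' (f A))
      (H4n_proj n \<omega>' (free_comult p))"
proof -
  have "H4n_tensor_cong n \<omega> (H4n_proj n \<omega> (free_comult q))
    (formal_map (map_prod f f) (H4n_proj n \<omega>' (free_comult p)))"
    using assms comult_hom[of "H4n_class n \<omega>' p"]
    by (simp add: represents_def comult_H4n tensor_map_class[OF carrier_linear carrier_linear]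
        tensor_class_eq_iff)
  from tensor_eval_cong[OF carrier_functional_class_coord[OF \<omega>] carrier_functional_class_coord[OF \<omega>] this]
  show ?thesis by (simp add: tensor_eval_H4n_proj[OF \<omega>] tensor_eval_formal_map)
qed

lemma represents_ftensor:
  assumes "represents p q" "represents p' q'"
  shows "tensor_eval (\<lambda>A. class_coord n \<omega> j i k (f A)) (\<lambda>A. class_coord n \<omega> j' i' k' (f A))
      (H4n_proj n \<omega>' (ftensor p p')) = coord n \<omega> j i k q * coord n \<omega> j' i' k' q'"
proof -
  have functional: "carrier_functional (H4n n \<omega>') (\<lambda>A. class_coord n \<omega> j i k (f A))" for j i k
    using carrier_functionalD[OF carrier_functional_class_coord[OF \<omega>]] carrier_linearD[OF carrier_linear]
    by (simp add: carrier_functional_def)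
  show ?thesis
    using tensor_eval_cong[OF functional functional H4n_proj_ftensor] assms
    by (simp add: represents_def class_coord_class[OF \<omega>])
qed

lemma represents_grouplike:
  assumes grp: "free_comult p = ftensor p p" and nz: "\<not> H4n_cong n \<omega>' p 0"
  obtains i k where "i < 2" "k < n" "represents p (fg ^ i * fc ^ k)"
proof -
  obtain q where q: "represents p q" by (rule represents_exists)
  have "represents 0 0" using represents_scalar[OF represents_1, of 0] by simp
  then have "q \<notin> H4n_ideal n \<omega>"
    using represents_cong_iff[OF q, of 0 0] nz by (simp add: H4n_cong_def)
  moreover have "tensor_eval (word_coord n \<omega> j i k) (word_coord n \<omega> j' i' k') (free_comult q) =
      coord n \<omega> j i k q * coord n \<omega> j' i' k' q" for j i k j' i' k'
    unfolding represents_comult[OF q] grp by (rule represents_ftensor[OF q q])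
  ultimately obtain i k where "i < 2" "k < n" "H4n_cong n \<omega> q (fg ^ i * fc ^ k)"
    using grouplike_cong[OF \<omega> n] by blast
  then show ?thesis using that represents_cong[OF q] by blast
qed

text \<open>
  The image of \<open>c\<close> is \<open>C = g\<^sup>e c\<^sup>s\<close> and the image of \<open>x\<close> is \<open>Y = b x + a (1 - h)\<close> with \<open>b \<noteq> 0\<close>, where \<open>h = g\<close> is the
  image of \<open>g\<close>. For \<open>m = n / gcd(s, n)\<close> the power \<open>C\<^sup>m = g\<^sup>e\<^sup>m\<close> is the image of \<open>1\<close> or of \<open>g\<close>, so
  \<open>c\<^sup>m\<close> is \<open>1\<close> or \<open>g\<close>. The latter is absurd, and the former forces \<open>gcd(s, n) = 1\<close>.
\<close>

lemma parameters:
  "\<exists>s<n. \<exists>e<2. coprime s n \<and> even (e * n) \<and> \<omega>' = (- 1) ^ e * \<omega> ^ s"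
proof -
  note cong = H4n_cong_iff_coord[OF \<omega> n] and cong' = H4n_cong_iff_coord[OF \<omega>' n]
  have "coord n \<omega>' 0 1 0 fg \<noteq> coord n \<omega>' 0 1 0 0" "coord n \<omega>' 0 0 1 fc \<noteq> coord n \<omega>' 0 0 1 0"
    by (simp_all add: coord_simps)
  then have nz: "\<not> H4n_cong n \<omega>' fg 0" "\<not> H4n_cong n \<omega>' fc 0"
    unfolding cong' by blast+
  obtain i k where h: "represents fg (fg ^ i * fc ^ k)"
    by (rule represents_grouplike[OF _ nz(1)]) simp_all
  obtain e s where e: "e < 2" and s: "s < n" and C: "represents fc (fg ^ e * fc ^ s)"
    by (rule represents_grouplike[OF _ nz(2)]) simp_all
  obtain X where X: "represents fx X" by (rule represents_exists)
  have skew: "tensor_eval (word_coord n \<omega> j i\<^sub>1 k\<^sub>1) (word_coord n \<omega> j' i' k') (free_comult X) =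
      coord n \<omega> j i\<^sub>1 k\<^sub>1 X * coord n \<omega> j' i' k' 1 +
      coord n \<omega> j i\<^sub>1 k\<^sub>1 (fg ^ i * fc ^ k) * coord n \<omega> j' i' k' X" for j i\<^sub>1 k\<^sub>1 j' i' k'
    unfolding represents_comult[OF X]
    by (simp add: H4n_proj_add tensor_eval_add represents_ftensor[OF X represents_1] represents_ftensor[OF h X])
  obtain a b where ab: "H4n_cong n \<omega> X (scalar b * fx + scalar a * (1 - fg ^ i * fc ^ k))"
    and b: "b \<noteq> 0 \<Longrightarrow> H4n_cong n \<omega> (fg ^ i * fc ^ k) fg"
    using skew_primitive_cong[OF \<omega> n skew] by metis
  define Y where "Y = scalar b * fx + scalar a * (1 - fg ^ i * fc ^ k)"
  have Y: "represents fx Y" unfolding Y_def by (rule represents_cong[OF X ab])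
  have "b \<noteq> 0"
  proof
    assume "b = 0"
    then have "represents fx (scalar a * (1 - fg ^ i * fc ^ k))" using Y by (simp add: Y_def)
    moreover have "represents (scalar a * (1 - fg)) (scalar a * (1 - fg ^ i * fc ^ k))"
      by (intro represents_scalar represents_diff represents_1 h)
    ultimately have "H4n_cong n \<omega>' fx (scalar a * (1 - fg))"
      using represents_cong_iff by fastforce
    then have "coord n \<omega>' 1 0 0 fx = coord n \<omega>' 1 0 0 (scalar a * (1 - fg))"
      unfolding cong' by blast
    then show False by (simp add: coord_simps)
  qed
  from b[OF this] have g: "represents fg fg" by (rule represents_cong[OF h])
  \<comment> \<open>Compare the coefficients of \<open>x g\<^sup>e c\<^sup>s\<close> in the image of the relation \<open>c x = \<omega>' x c\<close>.\<close>
  have "H4n_cong n \<omega> ((fg ^ e * fc ^ s) * Y) (scalar \<omega>' * (Y * (fg ^ e * fc ^ s)))"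
    using represents_cong_iff[OF represents_mult[OF C Y] represents_scalar[OF represents_mult[OF Y C]]]
      H4n_cong_relations(6) by blast
  then have "coord n \<omega> 1 (int e) (int s) ((fg ^ e * fc ^ s) * Y) =
    coord n \<omega> 1 (int e) (int s) (scalar \<omega>' * (Y * (fg ^ e * fc ^ s)))"
    unfolding cong by blast
  then have "b * ((- 1) ^ e * \<omega> ^ s) = b * \<omega>'"
    by (simp add: Y_def coord_simps mult.assoc distrib_right left_diff_distrib)
  then have \<omega>'_eq: "\<omega>' = (- 1) ^ e * \<omega> ^ s" using \<open>b \<noteq> 0\<close> by simp
  have "H4n_cong n \<omega> ((fg ^ e * fc ^ s) ^ n) 1"
    using represents_cong_iff[OF represents_power[OF C] represents_1] H4n_cong_relations(2) by blast
  then have "coord n \<omega> 0 0 0 ((fg ^ e * fc ^ s) ^ n) = coord n \<omega> 0 0 0 1"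
    unfolding cong by blast
  then have even: "even (e * n)"
    unfolding coord_gc_power coord_1 by (auto split: if_splits)
  define m where "m = n div gcd s n"
  have m: "m * gcd s n = n" by (simp add: m_def)
  have "s * m = n * (s div gcd s n)"
    by (metis m_def div_mult_swap gcd_dvd1 gcd_dvd2 mult.commute)
  then have sm: "int n dvd k - int (s * m) \<longleftrightarrow> int n dvd k" for k
    by (simp add: dvd_diff_left_iff)
  have "int n dvd int m"
  proof (cases "even (e * m)")
    case True
    then have "even (i - int (e * m)) \<longleftrightarrow> even i" for i by simp
    then have "H4n_cong n \<omega> ((fg ^ e * fc ^ s) ^ m) 1"
      unfolding cong coord_gc_power coord_1 sm by simp
    then have "H4n_cong n \<omega>' (fc ^ m) 1"
      using represents_cong_iff[OF represents_power[OF C] represents_1] by blast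
    then have "coord n \<omega>' 0 0 0 (fc ^ m) = coord n \<omega>' 0 0 0 1"
      unfolding cong' by blast
    then show ?thesis by (simp add: coord_simps split: if_splits)
  next
    case False
    then have "even (i - int (e * m)) \<longleftrightarrow> even (i - 1)" for i by simp
    then have "coord n \<omega> j i k ((fg ^ e * fc ^ s) ^ m) = coord n \<omega> j i k fg" for j i k
      unfolding coord_gc_power coord_g coord_1 sm by simp
    then have "H4n_cong n \<omega> ((fg ^ e * fc ^ s) ^ m) fg"
      unfolding cong by blast
    then have "H4n_cong n \<omega>' (fc ^ m) fg"
      using represents_cong_iff[OF represents_power[OF C] g] by blast
    then have "coord n \<omega>' 0 1 0 (fc ^ m) = coord n \<omega>' 0 1 0 fg"
      unfolding cong' by blast
    then show ?thesis by (simp add: coord_simps)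
  qed
  then have "n \<le> m" using m n by (intro dvd_imp_le) (auto intro: Nat.gr0I)
  moreover have "m > 0" using m n by (auto intro: Nat.gr0I)
  ultimately have "gcd s n = 1" using m n
    by (metis dvd_triv_left mult.right_neutral nat_dvd_not_less nat_less_le nat_mult_eq_cancel1)
  then show ?thesis using s e even \<omega>'_eq by (auto simp: coprime_iff_gcd_eq_1)
qed

end


section \<open>Isomorphisms from substitutions\<close>

definition subst_c :: "nat \<Rightarrow> nat \<Rightarrow> (gen, 'k::field) free_alg \<Rightarrow> (gen, 'k) free_alg"
  where "subst_c e s =
    free_lift scalar (\<lambda>a. case a of Gen_g \<Rightarrow> fg | Gen_x \<Rightarrow> fx | Gen_c \<Rightarrow> fg ^ e * fc ^ s)"

lemma subst_c_simps [simp]: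
  "subst_c e s (p + q) = subst_c e s p + subst_c e s q"
  "subst_c e s (p - q) = subst_c e s p - subst_c e s q"
  "subst_c e s (- p) = - subst_c e s p"
  "subst_c e s 0 = 0"
  "subst_c e s (p * q) = subst_c e s p * subst_c e s q"
  "subst_c e s (p ^ m) = subst_c e s p ^ m"
  "subst_c e s 1 = 1"
  "subst_c e s (scalar r) = scalar r"
  "subst_c e s (generator a) = (case a of Gen_g \<Rightarrow> fg | Gen_x \<Rightarrow> fx | Gen_c \<Rightarrow> fg ^ e * fc ^ s)"
  by (simp_all add: subst_c_def)

text \<open>
  Among the relators only \<open>c\<^sup>n - 1\<close> and \<open>c x - \<omega>' x c\<close> restrict the substitution: they require
  that \<open>e n\<close> is even and that \<open>g\<^sup>e c\<^sup>s\<close> moves past \<open>x\<close> at the price of \<open>\<omega>'\<close>.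
\<close>

lemma subst_c_ideal:
  assumes \<omega>: "\<omega> ^ n = 1" and n: "n > 0"
    and e: "even (e * n)" and \<omega>': "\<omega>' = (- 1) ^ e * \<omega> ^ s" and p: "p \<in> H4n_ideal n \<omega>'"
  shows "subst_c e s p \<in> H4n_ideal n \<omega>"
proof -
  let ?J = "{p. subst_c e s p \<in> H4n_ideal n \<omega>}"
  have "H4n_ideal n \<omega>' \<subseteq> ?J"
  proof (rule H4n_ideal_minimal)
    show "ideal ?J free_algebra"
      by (rule ideal_free_algebraI)
        (simp_all add: H4n_ideal_add H4n_ideal_left H4n_ideal_right)
    have "even (i - int (e * n)) \<longleftrightarrow> even i" for i using e by simp
    moreover have "int n dvd k - int (s * n) \<longleftrightarrow> int n dvd k" for k by (simp add: dvd_diff_left_iff)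
    ultimately have c: "subst_c e s (fc ^ n - 1) \<in> H4n_ideal n \<omega>"
      unfolding coord_eq_0_iff[OF \<omega> n] subst_c_simps gen.case coord_diff coord_gc_power coord_1 by simp
    have cg: "subst_c e s (fc * fg - fg * fc) \<in> H4n_ideal n \<omega>"
      unfolding coord_eq_0_iff[OF \<omega> n] by (simp add: mult.assoc coord_simps algebra_simps)
    have cx: "subst_c e s (fc * fx - scalar \<omega>' * (fx * fc)) \<in> H4n_ideal n \<omega>"
      unfolding coord_eq_0_iff[OF \<omega> n] by (simp add: mult.assoc coord_simps \<omega>')
    show "H4n_relators n \<omega>' \<subseteq> ?J"
      unfolding H4n_relators_def insert_subset mem_Collect_eq
      by (intro conjI empty_subsetI c cg cx) (simp_all add: H4n_ideal_relations)
  qed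
  then show ?thesis using p by blast
qed

text \<open>
  The substitution on both factors of the tensor square of the free algebra. There it commutes with
  the comultiplication exactly and not only modulo relations, because \<open>g\<^sup>e c\<^sup>s\<close> is already group-like
  in the free bialgebra.
\<close>

definition tensor_subst_c :: "nat \<Rightarrow> nat \<Rightarrow> (gen word \<times> gen word \<Rightarrow>\<^sub>0 'k::field)
    \<Rightarrow> (gen word \<times> gen word \<Rightarrow>\<^sub>0 'k)"
  where "tensor_subst_c e s T = (\<Sum>z\<in>Poly_Mapping.keys T. scalar (Poly_Mapping.lookup T z) *
    ftensor (subst_c e s (Poly_Mapping.single (fst z) 1)) (subst_c e s (Poly_Mapping.single (snd z) 1)))"

lemma additive_tensor_subst_c: "additive (tensor_subst_c e s)"
  unfolding tensor_subst_c_def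
  by (rule additive_keys_sum) (simp add: additive_def additive.add[OF additive_scalar] distrib_right)

lemmas tensor_subst_c_add = additive.add[OF additive_tensor_subst_c]

lemma tensor_subst_c_single:
  "tensor_subst_c e s (Poly_Mapping.single (u, v) r) =
    scalar r * ftensor (subst_c e s (Poly_Mapping.single u 1)) (subst_c e s (Poly_Mapping.single v 1))"
  by (cases "r = 0") (simp_all add: tensor_subst_c_def)

lemma tensor_subst_c_ftensor:
  "tensor_subst_c e s (ftensor p q) = ftensor (subst_c e s p) (subst_c e s q)"
proof (induction p rule: poly_mapping_induct)
  case (single u r)
  show ?case
  proof (induction q rule: poly_mapping_induct)
    case (single v r')
    have single: "Poly_Mapping.single w r = scalar r * Poly_Mapping.single w 1" for w r
      by (simp add: scalar_def mult_single)
    show ?case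
      unfolding ftensor_single tensor_subst_c_single
      unfolding single[of u r] single[of v r']
        subst_c_simps ftensor_scalar_left
      unfolding ftensor_scalar_right scalar_mult mult.assoc ..
  qed (simp add: ftensor_add tensor_subst_c_add)
qed (simp add: ftensor_add tensor_subst_c_add)

lemma tensor_subst_c_mult: "tensor_subst_c e s (S * T) = tensor_subst_c e s S * tensor_subst_c e s T"
proof (induction S rule: poly_mapping_induct)
  case (single z r)
  obtain u v where z: "z = (u, v)" by (cases z)
  show ?case
  proof (induction T rule: poly_mapping_induct)
    case (single z' r')
    obtain u' v' where z': "z' = (u', v')" by (cases z')
    have ft: "Poly_Mapping.single (a, b) c = ftensor (Poly_Mapping.single a c) (Poly_Mapping.single b 1)"
      for a b :: "gen word" and c :: 'a
      by (simp add: ftensor_single)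
    show ?case
      unfolding z z' ft ftensor_mult tensor_subst_c_ftensor subst_c_simps ..
  qed (simp add: distrib_left tensor_subst_c_add)
qed (simp add: distrib_right tensor_subst_c_add)

lemma free_comult_subst_c:
  fixes p :: "(gen, 'k::field) free_alg"
  shows "free_comult (subst_c e s p) = tensor_subst_c e s (free_comult p)"
proof (induction p rule: free_alg_induct)
  case (scalar r)
  have "tensor_subst_c e s (ftensor (scalar r) 1) = ftensor (scalar r) 1"
    unfolding tensor_subst_c_ftensor by simp
  then show ?case by simp
next
  case (generator a p)
  have "free_comult (subst_c e s (generator a)) = (tensor_subst_c e s (comult_gen a) :: _ \<Rightarrow>\<^sub>0 'k)"
    by (cases a) (simp_all add: tensor_subst_c_ftensor tensor_subst_c_add ftensor_power ftensor_mult)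
  then show ?case using generator by (simp only: subst_c_simps(5) free_lift_scalar_simps tensor_subst_c_mult)
qed (simp add: tensor_subst_c_add)

locale H4n_substitution =
  fixes n e s :: nat and \<omega> \<omega>' :: "'k::field"
  assumes n: "n > 0" and \<omega>: "\<omega> ^ n = 1" and \<omega>': "\<omega>' ^ n = 1"
    and e: "even (e * n)" and \<omega>'_eq: "\<omega>' = (- 1) ^ e * \<omega> ^ s"
begin

definition induced :: "(gen, 'k) free_alg set \<Rightarrow> (gen, 'k) free_alg set"
  where "induced A = the_elem ((\<lambda>p. H4n_class n \<omega> (subst_c e s p)) ` A)"

lemma subst_c_cong: "H4n_cong n \<omega>' p q \<Longrightarrow> H4n_cong n \<omega> (subst_c e s p) (subst_c e s q)"
  using subst_c_ideal[OF \<omega> n e \<omega>'_eq, of "p - q"] by (simp add: H4n_cong_def)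

lemma induced_class: "induced (H4n_class n \<omega>' p) = H4n_class n \<omega> (subst_c e s p)"
  unfolding induced_def
  by (rule the_elem_image_H4n_class) (simp add: H4n_class_eq_iff subst_c_cong)

lemma carrier_linear_induced: "carrier_linear (H4n n \<omega>') (H4n n \<omega>) induced"
  by (auto simp: carrier_linear_def H4n_simps induced_class)

lemma H4n_proj_tensor_subst_c:
  "H4n_tensor_cong n \<omega> (H4n_proj n \<omega> (tensor_subst_c e s T))
    (formal_map (map_prod induced induced) (H4n_proj n \<omega>' T))"
proof (induction T rule: poly_mapping_induct)
  case (single z r)
  obtain u v where z: "z = (u, v)" by (cases z)
  have "H4n_proj n \<omega> (scalar r * T) = fscale r (H4n_proj n \<omega> T)" for T
    by (simp add: H4n_proj_def formal_map_fscale flip: fscale_eq_scalar_mult)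
  then show ?case
    using tensor_cong_fscale[OF H4n_proj_ftensor, of n \<omega> r]
    by (simp add: z tensor_subst_c_single induced_class)
qed (simp add: tensor_subst_c_add H4n_proj_add formal_map_add tensor_cong_add)

text \<open>
  On \<open>c\<close>, the two sides are \<open>c\<^sup>(\<^sup>n\<^sup>-\<^sup>1\<^sup>)\<^sup>s g\<^sup>e\<close> and \<open>(g\<^sup>e c\<^sup>s)\<^sup>n\<^sup>-\<^sup>1\<close>. They agree because \<open>e (n - 1)\<close> and \<open>e\<close> have the
  same parity.
\<close>

lemma free_antipode_subst_c:
  "H4n_cong n \<omega> (free_antipode n (subst_c e s p)) (subst_c e s (free_antipode n p))"
proof (induction p rule: free_alg_induct)
  case (generator a p)
  have "H4n_cong n \<omega> (free_antipode n (subst_c e s (generator a))) (subst_c e s (free_antipode n (generator a)))"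
  proof (cases a)
    case Gen_c
    have par: "even (i - int e) \<longleftrightarrow> even (i - int (e * (n - 1)))" for i
      using e n by (cases n) auto
    have "coord n \<omega> j i k ((fc ^ (n - 1)) ^ s * fg ^ e) = coord n \<omega> j i k ((fg ^ e * fc ^ s) ^ (n - 1))" for j i k
    proof -
      have "coord n \<omega> j i k ((fc ^ (n - 1)) ^ s * fg ^ e) =
        (if j = 0 \<and> even (i - int e) \<and> int n dvd k - int (s * (n - 1)) then 1 else 0)"
        by (simp add: coord_c_power_mult coord_g_power coord_1 mult.commute flip: power_mult)
      then show ?thesis unfolding coord_gc_power par .
    qed
    then show ?thesis
      by (simp add: Gen_c H4n_cong_iff_coord[OF \<omega> n])
  qed simp_all
  from H4n_cong_trans[OF H4n_cong_mult_left[OF this] H4n_cong_mult_right[OF generator]]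
  show ?case by (simp only: subst_c_simps(5) free_antilift_simps)
qed (simp_all add: H4n_cong_add)

lemma induced_hopf_hom: "induced \<in> hopf_hom (H4n n \<omega>') (H4n n \<omega>)"
proof -
  have "induced \<in> ring_hom (H4n n \<omega>') (H4n n \<omega>)"
    by (rule ring_hom_memI) (auto simp: H4n_simps induced_class)
  moreover have "free_counit (subst_c e s p) = free_counit p" for p :: "(gen, 'k) free_alg"
  proof (induction p rule: free_alg_induct)
    case (generator a p)
    then show ?case by (cases a) simp_all
  qed simp_all
  moreover have "comult (H4n n \<omega>) (induced (H4n_class n \<omega>' p)) =
      tensor_map (H4n n \<omega>) (H4n n \<omega>) induced induced (comult (H4n n \<omega>') (H4n_class n \<omega>' p))" for p
    unfolding induced_class comult_H4n tensor_map_class[OF carrier_linear_induced carrier_linear_induced]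
      tensor_class_eq_iff free_comult_subst_c
    by (rule H4n_proj_tensor_subst_c)
  moreover have "antipode (H4n n \<omega>) (induced (H4n_class n \<omega>' p)) =
      induced (antipode (H4n n \<omega>') (H4n_class n \<omega>' p))" for p
    by (simp add: induced_class antipode_H4n[OF \<omega> n] antipode_H4n[OF \<omega>' n] H4n_class_eq_iff free_antipode_subst_c)
  ultimately show ?thesis
    by (auto simp: hopf_hom_def H4n_simps induced_class counit_H4n)
qed

end

lemma subst_c_inverse:
  assumes \<omega>: "\<omega> ^ n = 1" and n: "n > 0" and e: "even (e * (s' + 1))"
    and s: "int n dvd int (s * s') - 1"
  shows "H4n_cong n \<omega> (subst_c e s (subst_c e s' p)) p"
proof (induction p rule: free_alg_induct)
  case (generator a p)
  have "H4n_cong n \<omega> (subst_c e s (subst_c e s' (generator a))) (generator a)"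
  proof (cases a)
    case Gen_c
    \<comment> \<open>The composition maps \<open>c\<close> to \<open>g\<^sup>e (g\<^sup>e c\<^sup>s)\<^sup>s\<^sup>'\<close>, where \<open>g\<close> has exponent \<open>e (s' + 1)\<close>.\<close>
    have par: "even (i - int e - int (e * s')) \<longleftrightarrow> even i" for i
      using e by auto
    have dv: "int n dvd k - int (s * s') \<longleftrightarrow> int n dvd k - 1" for k
      using dvd_diff_left_iff[OF s, of "k - 1"] by simp
    have "coord n \<omega> j i k (fg ^ e * (fg ^ e * fc ^ s) ^ s') = coord n \<omega> j i k fc" for j i k
      by (simp only: coord_g_power_mult coord_gc_power par dv coord_c coord_1) simp
    then show ?thesis
      by (simp add: Gen_c H4n_cong_iff_coord[OF \<omega> n])
  qed simp_all
  from H4n_cong_trans[OF H4n_cong_mult_right[OF this] H4n_cong_mult_left[OF generator]]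
  show ?case by (simp only: subst_c_simps(5))
qed (simp_all add: H4n_cong_add)


text \<open>
  For \<open>n = 1\<close> the exponent \<open>s = 0\<close> is prime to \<open>n\<close>; it stands for \<open>c = 1\<close>.
\<close>

theorem H4n_isomorphic_iff:
  fixes \<omega> \<omega>' :: "'k::field"
  assumes n: "n > 0" and \<omega>: "\<omega> ^ n = 1" and \<omega>': "\<omega>' ^ n = 1"
  shows "hopf_isomorphic (H4n n \<omega>') (H4n n \<omega>) \<longleftrightarrow>
    (\<exists>s<n. \<exists>e<2. coprime s n \<and> even (e * n) \<and> \<omega>' = (- 1) ^ e * \<omega> ^ s)"
proof
  assume "hopf_isomorphic (H4n n \<omega>') (H4n n \<omega>)"
  then obtain f where "f \<in> hopf_hom (H4n n \<omega>') (H4n n \<omega>)"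
    and "inj_on f (carrier (H4n n \<omega>'))"
    by (auto simp: hopf_isomorphic_def bij_betw_def)
  then interpret H4n_hopf_mono n \<omega> \<omega>' f
    using assms by unfold_locales
  show "\<exists>s<n. \<exists>e<2. coprime s n \<and> even (e * n) \<and> \<omega>' = (- 1) ^ e * \<omega> ^ s"
    by (rule parameters)
next
  assume "\<exists>s<n. \<exists>e<2. coprime s n \<and> even (e * n) \<and> \<omega>' = (- 1) ^ e * \<omega> ^ s"
  then obtain s e where s: "coprime s n" and e: "even (e * n)" and \<omega>'_eq: "\<omega>' = (- 1) ^ e * \<omega> ^ s"
    by blast
  obtain s' where ss': "int n dvd int (s * s') - 1"
  proof (cases "s = 0")
    case True
    then show ?thesis using s that[of 0] by simp
  next
    case False
    then obtain x y where "s * x = n * y + 1"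
      using bezout_nat[of s n] s by auto
    then have "int (s * x) - 1 = int n * int y" by (metis add_diff_cancel_right' of_nat_1 of_nat_add of_nat_mult)
    then show ?thesis using that[of x] by simp
  qed
  \<comment> \<open>If \<open>n\<close> is even then \<open>s\<close> and \<open>s'\<close> are odd; otherwise \<open>e\<close> is even.\<close>
  have odd: "even (e * (s + 1))" "even (e * (s' + 1))"
  proof -
    have "odd s \<and> odd s'" if "even n"
    proof -
      have "odd (s * s')"
        using ss' that dvd_trans[of 2 "int n" "int (s * s') - 1"] by auto
      then show ?thesis by simp
    qed
    then show "even (e * (s + 1))" "even (e * (s' + 1))" using e by auto
  qed
  have "\<omega> ^ (s * s') = \<omega>"
  proof -
    have "\<omega> ^ m = \<omega> ^ (m mod n)" for m
      using \<omega> by (metis mult_div_mod_eq mult_1 power_add power_mult power_one)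
    moreover have "s * s' mod n = 1 mod n"
    proof -
      have "int (s * s') mod int n = 1 mod int n"
        using ss' unfolding mod_eq_dvd_iff .
      then have "int (s * s' mod n) = int (1 mod n)" by (simp only: of_nat_mod of_nat_1)
      then show ?thesis by (simp only: of_nat_eq_iff)
    qed
    ultimately show ?thesis by (metis power_one_right)
  qed
  moreover have "(- 1 :: 'k) ^ (e * (s' + 1)) = 1" using odd by simp
  ultimately have \<omega>_eq: "\<omega> = (- 1) ^ e * \<omega>' ^ s'"
    by (simp add: \<omega>'_eq power_mult_distrib power_add flip: power_mult mult.assoc)
  interpret F: H4n_substitution n e s \<omega> \<omega>'
    using assms e \<omega>'_eq by unfold_locales
  interpret G: H4n_substitution n e s' \<omega>' \<omega>
    using assms e \<omega>_eq by unfold_locales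
  have "bij_betw F.induced (carrier (H4n n \<omega>')) (carrier (H4n n \<omega>))"
  proof (rule bij_betw_byWitness[where f' = G.induced])
    show "\<forall>A\<in>carrier (H4n n \<omega>'). G.induced (F.induced A) = A"
      using subst_c_inverse[OF \<omega>' n odd(1), of s'] ss'
      by (auto simp: H4n_simps F.induced_class G.induced_class H4n_class_eq_iff mult.commute)
    show "\<forall>A\<in>carrier (H4n n \<omega>). F.induced (G.induced A) = A"
      using subst_c_inverse[OF \<omega> n odd(2), of s] ss'
      by (auto simp: H4n_simps F.induced_class G.induced_class H4n_class_eq_iff)
  qed (auto simp: H4n_simps F.induced_class G.induced_class)
  then show "hopf_isomorphic (H4n n \<omega>') (H4n n \<omega>)"
    using F.induced_hopf_hom by (auto simp: hopf_isomorphic_def)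
qed

section \<open>Exponents of roots of unity\<close>

text \<open>
  If \<open>d\<close> is the least positive exponent with \<open>\<xi>\<^sup>d = 1\<close>, then the powers of \<open>\<xi>\<close> are the \<open>d\<close>
  distinct elements \<open>\<xi>\<^sup>i\<close> with \<open>i < d\<close>, so \<open>d\<close> is the number of roots of unity.
\<close>

lemma generator_power_eq_1_iff:
  fixes \<xi> :: "'k::field"
  assumes n: "n > 0" and gen: "generates_roots_of_unity n \<xi>"
  shows "\<xi> powi a = 1 \<longleftrightarrow> int (card (roots_of_unity n :: 'k set)) dvd a"
proof -
  have "\<xi> powi 1 \<in> roots_of_unity n"
    using gen unfolding generates_roots_of_unity_def by blast
  then have \<xi>: "\<xi> ^ n = 1" by (simp add: roots_of_unity_def)
  then have nz: "\<xi> \<noteq> 0" using n by (auto simp: power_0_left)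
  define d where "d = (LEAST d. d > 0 \<and> \<xi> ^ d = 1)"
  have d: "d > 0" "\<xi> ^ d = 1"
    using LeastI[of "\<lambda>d. d > 0 \<and> \<xi> ^ d = 1" n] n \<xi> by (simp_all add: d_def)
  have least: "m = 0" if "\<xi> ^ m = 1" "m < d" for m
    using not_less_Least[of m "\<lambda>d. d > 0 \<and> \<xi> ^ d = 1"] that by (auto simp: d_def)
  have red: "\<xi> powi a = \<xi> ^ nat (a mod int d)" for a
  proof -
    have "\<xi> powi a = \<xi> powi (int d * (a div int d) + a mod int d)" by simp
    also have "\<dots> = \<xi> powi (int d * (a div int d)) * \<xi> powi (a mod int d)"
      using nz by (intro power_int_add) simp
    also have "\<dots> = \<xi> powi (a mod int d)"
      using d by (simp add: power_int_mult)
    finally have "\<xi> powi a = \<xi> powi (a mod int d)" .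
    then show ?thesis using d(1) by (simp add: power_int_def)
  qed
  have "inj_on (\<lambda>i. \<xi> ^ i) {..<d}"
  proof (rule linorder_inj_onI)
    fix i j assume ij: "i < j" "i \<in> {..<d}" "j \<in> {..<d}"
    show "\<xi> ^ i \<noteq> \<xi> ^ j"
    proof
      assume "\<xi> ^ i = \<xi> ^ j"
      then have "\<xi> ^ (j - i) = 1" using ij nz by (simp add: power_diff)
      then show False using least[of "j - i"] ij by (simp add: less_imp_diff_less)
    qed
  qed auto
  moreover have "roots_of_unity n = (\<lambda>i. \<xi> ^ i) ` {..<d}"
  proof -
    have "\<xi> ^ i \<in> range (\<lambda>i::int. \<xi> powi i)" for i
      by (rule range_eqI[of _ _ "int i"]) simp
    moreover have "\<xi> powi a \<in> (\<lambda>i. \<xi> ^ i) ` {..<d}" for a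
      unfolding red using d(1) by (intro imageI) (simp add: nat_less_iff)
    ultimately show ?thesis
      unfolding gen[unfolded generates_roots_of_unity_def] by (intro equalityI image_subsetI)
  qed
  ultimately have card: "card (roots_of_unity n :: 'k set) = d" by (simp add: card_image)
  have "\<xi> powi a = 1 \<longleftrightarrow> nat (a mod int d) = 0"
    unfolding red using least[of "nat (a mod int d)"] d(1) by (auto simp: nat_less_iff)
  also have "\<dots> \<longleftrightarrow> int d dvd a"
    using d(1) by (auto simp: dvd_eq_mod_eq_0 nat_eq_iff)
  finally show ?thesis by (simp add: card)
qed

theorem theorem4p7:
  fixes \<xi> :: "'k::field" and n \<nu> l t :: nat
  assumes "CHAR('k) \<noteq> 2"
    and "n > 0"
    and "\<nu> = card (roots_of_unity n :: 'k set)"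
    and "generates_roots_of_unity n \<xi>"
    and "l \<in> {0..\<nu> - 1}" and "t \<in> {0..\<nu> - 1}"
  shows
    "(odd n \<or> odd \<nu> \<longrightarrow>
       (hopf_isomorphic (H4n n (\<xi> ^ l)) (H4n n (\<xi> ^ t)) \<longleftrightarrow>
         (\<exists>s\<in>{0..n - 1}. gcd s n = 1 \<and> int \<nu> dvd int l - int t * int s))) \<and>
     (even n \<and> even \<nu> \<longrightarrow>
       (hopf_isomorphic (H4n n (\<xi> ^ l)) (H4n n (\<xi> ^ t)) \<longleftrightarrow>
         (\<exists>s\<in>{0..n - 1}. gcd s n = 1 \<and>
           (int \<nu> dvd int l - int t * int s \<or>
            (\<exists>q::int. odd q \<and> 2 * (int l - int t * int s) = int \<nu> * q)))))"
proof -
  note power_1_iff = generator_power_eq_1_iff[OF assms(2,4), folded assms(3)]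
  have "\<xi> powi 1 \<in> roots_of_unity n"
    using assms(4) unfolding generates_roots_of_unity_def by blast
  then have \<xi>: "\<xi> ^ n = 1" by (simp add: roots_of_unity_def)
  then have nz: "\<xi> \<noteq> 0" using assms(2) by (auto simp: power_0_left)
  have root: "(\<xi> ^ m) ^ n = 1" for m
    using \<xi> by (metis mult.commute power_mult power_one)
  have quot: "\<xi> ^ l = r * (\<xi> ^ t) ^ s \<longleftrightarrow> \<xi> powi (int l - int t * int s) = r" for r s
  proof -
    have "\<xi> powi (int t * int s) = (\<xi> ^ t) ^ s"
      by (metis of_nat_mult power_int_of_nat power_mult)
    then show ?thesis using nz by (simp add: power_int_diff nonzero_divide_eq_eq)
  qed
  have range: "s \<in> {0..n - 1} \<longleftrightarrow> s < n" for s using assms(2) by auto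
  note iso = H4n_isomorphic_iff[OF assms(2) root[of t] root[of l], unfolded quot]
  show ?thesis
  proof (intro conjI impI)
    assume odd: "odd n \<or> odd \<nu>"
    have sign: "(- 1 :: 'k) ^ e = 1" if "even (e * n)" for e
    proof (cases "odd n")
      case True
      then show ?thesis using that by simp
    next
      case False
      \<comment> \<open>Here \<open>-1\<close> is an \<open>n\<close>-th root of unity of odd order, hence \<open>-1 = 1\<close>.\<close>
      then have "- 1 \<in> (roots_of_unity n :: 'k set)" by (simp add: roots_of_unity_def)
      then obtain a where a: "- 1 = \<xi> powi a"
        using assms(4) unfolding generates_roots_of_unity_def by blast
      have "(- 1 :: 'k) ^ \<nu> = \<xi> powi (a * int \<nu>)" unfolding a by (simp add: power_int_mult)
      also have "\<dots> = 1" unfolding power_1_iff by simp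
      finally show ?thesis using odd False by (cases "even e") simp_all
    qed
    have "(\<exists>e<2. coprime s n \<and> even (e * n) \<and> \<xi> powi (int l - int t * int s) = (- 1) ^ e)
      \<longleftrightarrow> coprime s n \<and> int \<nu> dvd int l - int t * int s" for s
      unfolding power_1_iff[symmetric]
    proof
      assume "\<exists>e<2. coprime s n \<and> even (e * n) \<and> \<xi> powi (int l - int t * int s) = (- 1) ^ e"
      then show "coprime s n \<and> \<xi> powi (int l - int t * int s) = 1"
        using sign by metis
    next
      assume "coprime s n \<and> \<xi> powi (int l - int t * int s) = 1"
      then show "\<exists>e<2. coprime s n \<and> even (e * n) \<and> \<xi> powi (int l - int t * int s) = (- 1) ^ e"
        by (intro exI[of _ "0::nat"]) simp
    qed
    then show "hopf_isomorphic (H4n n (\<xi> ^ l)) (H4n n (\<xi> ^ t)) \<longleftrightarrow>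
         (\<exists>s\<in>{0..n - 1}. gcd s n = 1 \<and> int \<nu> dvd int l - int t * int s)"
      unfolding iso Bex_def range by (simp add: coprime_iff_gcd_eq_1)
  next
    assume even: "even n \<and> even \<nu>"
    then obtain m where m: "\<nu> = 2 * m" by blast
    have "\<nu> > 0"
      using assms(2) \<xi> power_1_iff[of "int n"] by (auto intro!: Nat.gr0I)
    have "\<xi> powi int m \<noteq> 1" unfolding power_1_iff using m \<open>\<nu> > 0\<close> by (auto dest: zdvd_imp_le)
    moreover have "(\<xi> powi int m)\<^sup>2 = 1"
    proof -
      have "(\<xi> powi int m)\<^sup>2 = \<xi> ^ \<nu>" by (simp add: m mult.commute flip: power_mult)
      also have "\<dots> = 1" using power_1_iff[of "int \<nu>"] by simp
      finally show ?thesis .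
    qed
    ultimately have minus_1: "- 1 = \<xi> powi int m" unfolding power2_eq_1_iff by simp
    have minus_1_iff: "\<xi> powi d = - 1 \<longleftrightarrow> (\<exists>q. odd q \<and> 2 * d = int \<nu> * q)" for d
    proof -
      have "\<xi> powi d = - 1 \<longleftrightarrow> \<xi> powi (d - int m) = 1"
        unfolding minus_1 using nz by (simp add: power_int_diff)
      also have "\<dots> \<longleftrightarrow> (\<exists>c. d - int m = int \<nu> * c)" unfolding power_1_iff dvd_def ..
      also have "\<dots> \<longleftrightarrow> (\<exists>c. 2 * d = int \<nu> * (2 * c + 1))"
      proof -
        have "d - int m = int \<nu> * c \<longleftrightarrow> 2 * d = int \<nu> * (2 * c + 1)" for c
          unfolding m by (auto simp: algebra_simps)
        then show ?thesis by (simp only:)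
      qed
      also have "\<dots> \<longleftrightarrow> (\<exists>q. odd q \<and> 2 * d = int \<nu> * q)"
      proof
        assume "\<exists>c. 2 * d = int \<nu> * (2 * c + 1)"
        then obtain c where "2 * d = int \<nu> * (2 * c + 1)" by blast
        moreover have "odd (2 * c + 1)" by simp
        ultimately show "\<exists>q. odd q \<and> 2 * d = int \<nu> * q" by blast
      next
        assume "\<exists>q. odd q \<and> 2 * d = int \<nu> * q"
        then obtain q where "odd q" "2 * d = int \<nu> * q" by blast
        then show "\<exists>c. 2 * d = int \<nu> * (2 * c + 1)" by (metis oddE)
      qed
      finally show ?thesis .
    qed
    have "(\<exists>e<2. coprime s n \<and> even (e * n) \<and> \<xi> powi d = (- 1) ^ e)
      \<longleftrightarrow> coprime s n \<and> (\<xi> powi d = 1 \<or> \<xi> powi d = - 1)" for s d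
      using even by (auto simp: less_2_cases_iff)
    then show "hopf_isomorphic (H4n n (\<xi> ^ l)) (H4n n (\<xi> ^ t)) \<longleftrightarrow>
         (\<exists>s\<in>{0..n - 1}. gcd s n = 1 \<and> (int \<nu> dvd int l - int t * int s \<or>
            (\<exists>q::int. odd q \<and> 2 * (int l - int t * int s) = int \<nu> * q)))"
      unfolding iso Bex_def range by (simp add: coprime_iff_gcd_eq_1 power_1_iff minus_1_iff)
  qed
qed

end
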